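(* Let $L$ be a simply connected smooth manifold of dimension $l$, let $X=c^{\circ}(L)$ be the open cone on $L$, and let $\overline{p}$ be an extended perversity. Then the homology of the perversity $\overline{p}$ intersection space $I^{\overline{p}}X$ of $X$ is given by $$\widetilde{H}I^{\overline{p}}_j(X)\cong\begin{cases} 0 & \text{if } 0<j<l-\overline{p}(l+1),\\ \widetilde{H}_j(L) & \text{otherwise.}\end{cases}$$
   Context: Homology is singular homology with real coefficients; $\widetilde{H}_*$ denotes reduced homology. Dimension means real dimension. An extended perversity $\overline{p}$ is just a sequence of integers $\overline{p}(n)$. The open cone is $c^{\circ}(L)=\big((0,1]\times L\big)/\big((1,x)\sim(1,x')\big)$, and $c(Z)=\big(Z\times[0,1]\big)/\big((z,1)\sim(z',1)\big)$ denotes the closed cone on a space $Z$ (so $c(\emptyset)=\emptyset$). Put $k=l-\overline{p}(l+1)$. A stage $k$ Moore approximation of $L$ is a continuous map $f:L_{<k}\to L$ from a (CW) space $L_{<k}$ such that $H_i(L_{<k})=0$ for $i\ge k$ and $f_*:H_i(L_{<k})\to H_i(L)$ is an isomorphism for $i<k$. (For $k\le 0$, $L_{<k}=\emptyset$.) Fix a stage $k$ Moore approximation $f:L_{<k}\to L$. The perversity $\overline{p}$ intersection space of $X=c^{\circ}(L)$ is $$I^{\overline{p}}X=\frac{\big(L\times[0,1)\big)\sqcup c(L_{<k})}{(f(x),0)\sim(x,0),\ x\in L_{<k}},$$ where $(f(x),0)\in L\times[0,1)$ and $(x,0)$ is the point of $c(L_{<k})$ in the base of the cone. One sets $\widetilde{H}I^{\overline{p}}_j(X)=\widetilde{H}_j(I^{\overline{p}}X;\mathbb{R})$.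 *)

theory Defs
  imports "HOL-Analysis.Analysis" "HOL-Homology.Homology"
begin

section \<open>Quotients, disjoint sums and cones\<close>

text \<open>The equivalence relation on the points of \<open>X\<close> generated by \<open>r\<close>.\<close>

definition gluing_rel :: "'a topology \<Rightarrow> 'a rel \<Rightarrow> 'a rel" where
  "gluing_rel X r = (let s = r \<inter> topspace X \<times> topspace X
                     in (s \<union> s\<inverse>)\<^sup>* \<inter> topspace X \<times> topspace X)"

definition quotient_space :: "'a topology \<Rightarrow> 'a rel \<Rightarrow> 'a set topology" where
  "quotient_space X r = topology (\<lambda>U. U \<subseteq> topspace X // gluing_rel X r \<and>
     openin X {x \<in> topspace X. gluing_rel X r `` {x} \<in> U})"

definition disjoint_sum :: "'a topology \<Rightarrow> 'b topology \<Rightarrow> ('a + 'b) topology" where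
  "disjoint_sum X Y = topology (\<lambda>U. openin X (Inl -` U) \<and> openin Y (Inr -` U))"

lemma equiv_gluing_rel: "equiv (topspace X) (gluing_rel X r)"
proof -
  have "sym ((s \<union> s\<inverse>)\<^sup>*)" for s :: "'a rel"
    by (intro sym_rtrancl sym_Un_converse)
  then show ?thesis
    unfolding gluing_rel_def Let_def
    by (intro equivI refl_onI symI transI) (auto dest: symD)
qed

lemma openin_quotient_space:
  "openin (quotient_space X r) U \<longleftrightarrow> U \<subseteq> topspace X // gluing_rel X r \<and>
     openin X {x \<in> topspace X. gluing_rel X r `` {x} \<in> U}"
proof -
  define q where "q = (\<lambda>x. gluing_rel X r `` {x})"
  have 1: "{x \<in> topspace X. q x \<in> S \<inter> T} = {x \<in> topspace X. q x \<in> S} \<inter> {x \<in> topspace X. q x \<in> T}"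
    for S T by auto
  have 2: "{x \<in> topspace X. q x \<in> \<Union> K} = (\<Union>S\<in>K. {x \<in> topspace X. q x \<in> S})" for K
    by auto
  have "istopology (\<lambda>U. U \<subseteq> topspace X // gluing_rel X r \<and> openin X {x \<in> topspace X. q x \<in> U})"
    unfolding istopology_def 1 2 by blast
  then show ?thesis
    unfolding quotient_space_def q_def by (simp add: topology_inverse')
qed

lemma topspace_quotient_space: "topspace (quotient_space X r) = topspace X // gluing_rel X r"
proof -
  have "{x \<in> topspace X. gluing_rel X r `` {x} \<in> topspace X // gluing_rel X r} = topspace X"
    by (auto simp: quotient_def)
  then have "openin (quotient_space X r) (topspace X // gluing_rel X r)"
    by (simp add: openin_quotient_space)
  then show ?thesis
    by (metis openin_quotient_space openin_subset openin_topspace subset_antisym)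
qed

lemma quotient_map_quotient_space:
  "quotient_map X (quotient_space X r) (\<lambda>x. gluing_rel X r `` {x})"
  by (auto simp: quotient_map_def topspace_quotient_space openin_quotient_space quotient_def)

lemma openin_disjoint_sum:
  "openin (disjoint_sum X Y) U \<longleftrightarrow> openin X (Inl -` U) \<and> openin Y (Inr -` U)"
proof -
  have "istopology (\<lambda>U. openin X (Inl -` U) \<and> openin Y (Inr -` U))"
    unfolding istopology_def vimage_Int vimage_Union by blast
  then show ?thesis
    unfolding disjoint_sum_def by (simp add: topology_inverse')
qed

lemma topspace_disjoint_sum: "topspace (disjoint_sum X Y) = topspace X <+> topspace Y"
proof
  have "openin X (Inl -` topspace (disjoint_sum X Y))" "openin Y (Inr -` topspace (disjoint_sum X Y))"
    using openin_disjoint_sum by blast+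
  then show "topspace (disjoint_sum X Y) \<subseteq> topspace X <+> topspace Y"
    by (auto dest!: openin_subset simp: subset_iff split_sum_all)
  have "Inl -` (topspace X <+> topspace Y) = topspace X" "Inr -` (topspace X <+> topspace Y) = topspace Y"
    by auto
  then show "topspace X <+> topspace Y \<subseteq> topspace (disjoint_sum X Y)"
    by (intro openin_subset) (simp add: openin_disjoint_sum)
qed

definition open_cone :: "'a topology \<Rightarrow> (real \<times> 'a) set topology" where
  "open_cone L = quotient_space (prod_topology (top_of_set {0<..1}) L)
     {((1, x), (1, x')) | x x'. True}"

definition cone_rel :: "('a \<times> real) rel" where
  "cone_rel = {((z, 1), (z', 1)) | z z'. True}"

definition closed_cone :: "'a topology \<Rightarrow> ('a \<times> real) set topology" where
  "closed_cone Z = quotient_space (prod_topology Z (top_of_set {0..1})) cone_rel"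

text \<open>The point of \<open>closed_cone Z\<close> represented by \<open>(z, 0)\<close>.\<close>

definition cone_base :: "'a topology \<Rightarrow> 'a \<Rightarrow> ('a \<times> real) set" where
  "cone_base Z z = gluing_rel (prod_topology Z (top_of_set {0..1})) cone_rel `` {(z, 0)}"

section \<open>Singular homology with real coefficients\<close>

type_synonym 'a real_chain = "((nat \<Rightarrow> real) \<Rightarrow> 'a) \<Rightarrow>\<^sub>0 real"

definition chain_scale :: "real \<Rightarrow> 'a real_chain \<Rightarrow> 'a real_chain" where
  "chain_scale a c = Poly_Mapping.map ((*) a) c"

definition real_chains :: "nat \<Rightarrow> 'a topology \<Rightarrow> 'a real_chain set" where
  "real_chains p X = {c. Poly_Mapping.keys c \<subseteq> singular_simplex_set p X}"

definition real_boundary :: "nat \<Rightarrow> 'a real_chain \<Rightarrow> 'a real_chain" where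
  "real_boundary p c = (if p = 0 then 0 else
     (\<Sum>s\<in>Poly_Mapping.keys c. \<Sum>k\<le>p.
        Poly_Mapping.single (singular_face p k s) ((-1) ^ k * Poly_Mapping.lookup c s)))"

definition real_chain_map :: "nat \<Rightarrow> ('a \<Rightarrow> 'b) \<Rightarrow> 'a real_chain \<Rightarrow> 'b real_chain" where
  "real_chain_map p g c =
     (\<Sum>s\<in>Poly_Mapping.keys c. Poly_Mapping.single (simplex_map p g s) (Poly_Mapping.lookup c s))"

definition real_cycles :: "nat \<Rightarrow> 'a topology \<Rightarrow> 'a real_chain set" where
  "real_cycles p X = {c \<in> real_chains p X. real_boundary p c = 0}"

definition real_boundaries :: "nat \<Rightarrow> 'a topology \<Rightarrow> 'a real_chain set" where
  "real_boundaries p X = real_boundary (Suc p) ` real_chains (Suc p) X"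

text \<open>Cycles of the augmented complex: in degree 0 the coefficients have to sum to zero.\<close>

definition reduced_real_cycles :: "nat \<Rightarrow> 'a topology \<Rightarrow> 'a real_chain set" where
  "reduced_real_cycles p X = {c \<in> real_cycles p X.
     p = 0 \<longrightarrow> (\<Sum>s\<in>Poly_Mapping.keys c. Poly_Mapping.lookup c s) = 0}"

text \<open>The real vector space \<open>Z / B\<close> of cosets \<open>z + B\<close>.  As for any module in HOL-Algebra, the ring
  operations \<open>mult\<close> and \<open>one\<close> of the record play no role.\<close>

definition chain_quotient ::
    "'a real_chain set \<Rightarrow> 'a real_chain set \<Rightarrow> (real, 'a real_chain set) module" where
  "chain_quotient Z B =
     \<lparr>carrier = (\<lambda>z. (+) z ` B) ` Z, mult = undefined, one = undefined, zero = B,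
      add = (\<lambda>C D. {c + d | c d. c \<in> C \<and> d \<in> D}),
      smult = (\<lambda>a C. {chain_scale a c + b | c b. c \<in> C \<and> b \<in> B})\<rparr>"

definition real_homology :: "nat \<Rightarrow> 'a topology \<Rightarrow> (real, 'a real_chain set) module" where
  "real_homology p X = chain_quotient (real_cycles p X) (real_boundaries p X)"

definition reduced_real_homology :: "nat \<Rightarrow> 'a topology \<Rightarrow> (real, 'a real_chain set) module" where
  "reduced_real_homology p X = chain_quotient (reduced_real_cycles p X) (real_boundaries p X)"

text \<open>For continuous \<open>g : X \<rightarrow> Y\<close>, this sends the class of \<open>c\<close> to the class of its image in
  \<open>real_homology p Y\<close>.\<close>

definition real_hom_induced ::
    "nat \<Rightarrow> 'b topology \<Rightarrow> ('a \<Rightarrow> 'b) \<Rightarrow> 'a real_chain set \<Rightarrow> 'b real_chain set" where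
  "real_hom_induced p Y g C = {real_chain_map p g c + b | c b. c \<in> C \<and> b \<in> real_boundaries p Y}"

definition linear_iso ::
    "(real, 'a, 'm) module_scheme \<Rightarrow> (real, 'b, 'n) module_scheme \<Rightarrow> ('a \<Rightarrow> 'b) \<Rightarrow> bool" where
  "linear_iso M N h \<longleftrightarrow> bij_betw h (carrier M) (carrier N) \<and>
     (\<forall>x\<in>carrier M. \<forall>y\<in>carrier M. h (x \<oplus>\<^bsub>M\<^esub> y) = h x \<oplus>\<^bsub>N\<^esub> h y) \<and>
     (\<forall>a. \<forall>x\<in>carrier M. h (a \<odot>\<^bsub>M\<^esub> x) = a \<odot>\<^bsub>N\<^esub> h x)"

definition linearly_isomorphic ::
    "(real, 'a, 'm) module_scheme \<Rightarrow> (real, 'b, 'n) module_scheme \<Rightarrow> bool" where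
  "linearly_isomorphic M N \<longleftrightarrow> (\<exists>h. linear_iso M N h)"

definition zero_module :: "(real, 'a, 'm) module_scheme \<Rightarrow> bool" where
  "zero_module M \<longleftrightarrow> carrier M = {\<zero>\<^bsub>M\<^esub>}"

section \<open>Smooth manifolds\<close>

text \<open>\<open>C_diff n r U g\<close>: the function \<open>g\<close> is of class \<open>C\<^sup>r\<close> on \<open>U\<close>, an open subset of
  \<open>Euclidean_space n\<close>; that is, its iterated partial derivatives of order up to \<open>r\<close> exist and are
  continuous.\<close>

fun C_diff :: "nat \<Rightarrow> nat \<Rightarrow> (nat \<Rightarrow> real) set \<Rightarrow> ((nat \<Rightarrow> real) \<Rightarrow> real) \<Rightarrow> bool" where
  "C_diff n 0 U g \<longleftrightarrow> continuous_map (subtopology (Euclidean_space n) U) euclideanreal g"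
| "C_diff n (Suc r) U g \<longleftrightarrow>
     continuous_map (subtopology (Euclidean_space n) U) euclideanreal g \<and>
     (\<forall>i<n. \<exists>g'. (\<forall>x\<in>U. ((\<lambda>t. g (x(i := t))) has_real_derivative g' x) (at (x i))) \<and>
                 C_diff n r U g')"

definition smooth_map_on ::
    "nat \<Rightarrow> (nat \<Rightarrow> real) set \<Rightarrow> ((nat \<Rightarrow> real) \<Rightarrow> nat \<Rightarrow> real) \<Rightarrow> bool" where
  "smooth_map_on n U h \<longleftrightarrow> (\<forall>i<n. \<forall>r. C_diff n r U (\<lambda>x. h x i))"

definition smooth_manifold ::
    "nat \<Rightarrow> 'a topology \<Rightarrow> ('a set \<times> ('a \<Rightarrow> nat \<Rightarrow> real)) set \<Rightarrow> bool" where
  "smooth_manifold n M \<A> \<longleftrightarrow>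
     Hausdorff_space M \<and> second_countable M \<and>
     (\<Union>(U, \<phi>)\<in>\<A>. U) = topspace M \<and>
     (\<forall>(U, \<phi>)\<in>\<A>. openin M U \<and> openin (Euclidean_space n) (\<phi> ` U) \<and>
        homeomorphic_map (subtopology M U) (subtopology (Euclidean_space n) (\<phi> ` U)) \<phi>) \<and>
     (\<forall>(U, \<phi>)\<in>\<A>. \<forall>(V, \<psi>)\<in>\<A>. smooth_map_on n (\<phi> ` (U \<inter> V)) (\<psi> \<circ> inv_into U \<phi>))"

definition simply_connected_space :: "'a topology \<Rightarrow> bool" where
  "simply_connected_space X \<longleftrightarrow> topspace X \<noteq> {} \<and> path_connected_space X \<and>
     (\<forall>g. pathin X g \<and> g 0 = g 1 \<longrightarrow>
        homotopic_with (\<lambda>h. h 0 = g 0 \<and> h 1 = g 0) (top_of_set {0..1}) X g (\<lambda>_. g 0))"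

section \<open>CW complexes\<close>

definition closed_disc :: "nat \<Rightarrow> (nat \<Rightarrow> real) set" where
  "closed_disc n = {x \<in> topspace (Euclidean_space n). (\<Sum>i<n. (x i)\<^sup>2) \<le> 1}"

definition open_disc :: "nat \<Rightarrow> (nat \<Rightarrow> real) set" where
  "open_disc n = {x \<in> topspace (Euclidean_space n). (\<Sum>i<n. (x i)\<^sup>2) < 1}"

text \<open>A cell is given by its dimension and its characteristic map.  That a characteristic map is a
  homeomorphism from the open disc onto the open cell follows from the other conditions.\<close>

definition CW_structure :: "'a topology \<Rightarrow> (nat \<times> ((nat \<Rightarrow> real) \<Rightarrow> 'a)) set \<Rightarrow> bool" where
  "CW_structure Z E \<longleftrightarrow> Hausdorff_space Z \<and>
     (\<forall>(n, \<phi>)\<in>E. continuous_map (subtopology (Euclidean_space n) (closed_disc n)) Z \<phi> \<and>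
        inj_on \<phi> (open_disc n)) \<and>
     (\<Union>(n, \<phi>)\<in>E. \<phi> ` open_disc n) = topspace Z \<and>
     pairwise (\<lambda>(n, \<phi>) (m, \<psi>). disjnt (\<phi> ` open_disc n) (\<psi> ` open_disc m)) E \<and>
     (\<forall>(n, \<phi>)\<in>E. \<exists>F. finite F \<and> F \<subseteq> {(m, \<psi>). (m, \<psi>) \<in> E \<and> m < n} \<and>
        \<phi> ` (closed_disc n - open_disc n) \<subseteq> (\<Union>(m, \<psi>)\<in>F. \<psi> ` open_disc m)) \<and>
     (\<forall>A \<subseteq> topspace Z. closedin Z A \<longleftrightarrow>
        (\<forall>(n, \<phi>)\<in>E. closedin (subtopology (Euclidean_space n) (closed_disc n))
                         {x \<in> closed_disc n. \<phi> x \<in> A}))"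

definition CW_space :: "'a topology \<Rightarrow> bool" where
  "CW_space Z \<longleftrightarrow> (\<exists>E. CW_structure Z E)"

section \<open>Intersection spaces of open cones\<close>

definition moore_approximation ::
    "int \<Rightarrow> 'a topology \<Rightarrow> 'b topology \<Rightarrow> ('b \<Rightarrow> 'a) \<Rightarrow> bool" where
  "moore_approximation k L Z f \<longleftrightarrow>
     CW_space Z \<and> continuous_map Z L f \<and>
     (k \<le> 0 \<longrightarrow> topspace Z = {}) \<and>
     (\<forall>i. int i \<ge> k \<longrightarrow> zero_module (real_homology i Z)) \<and>
     (\<forall>i. int i < k \<longrightarrow>
        linear_iso (real_homology i Z) (real_homology i L) (real_hom_induced i L f))"

text \<open>The quotient of \<open>L \<times> [0,1) \<squnion> c(Z)\<close> by \<open>(f(x), 0) \<sim> (x, 0)\<close>.\<close>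

definition glue_cone :: "'a topology \<Rightarrow> 'b topology \<Rightarrow> ('b \<Rightarrow> 'a) \<Rightarrow>
    (('a \<times> real) + ('b \<times> real) set) set topology" where
  "glue_cone L Z f =
     quotient_space
       (disjoint_sum (prod_topology L (top_of_set {0..<1})) (closed_cone Z))
       {(Inl (f x, 0), Inr (cone_base Z x)) | x. x \<in> topspace Z}"

text \<open>\<open>IX\<close> is a perversity \<open>p\<close> intersection space of the open cone \<open>X\<close> on the \<open>l\<close>-dimensional
  link \<open>L\<close>, built from some Moore approximation of the stage prescribed by \<open>p\<close>.\<close>

definition is_intersection_space ::
    "(nat \<Rightarrow> int) \<Rightarrow> nat \<Rightarrow> 'a topology \<Rightarrow> (real \<times> 'a) set topology \<Rightarrow>
     (('a \<times> real) + ('b \<times> real) set) set topology \<Rightarrow> bool" where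
  "is_intersection_space p l L X IX \<longleftrightarrow> X = open_cone L \<and>
     (\<exists>Z f. moore_approximation (int l - p (l + 1)) L Z f \<and> IX = glue_cone L Z f)"

end

theory Submission
  imports Defs
begin

text \<open>
  Write \<open>IX\<close> as the union of the open sets \<open>U\<close>, the cylinder together with the part \<open>s < 2/3\<close> of the
  cone, and \<open>V\<close>, the part \<open>s > 1/3\<close> of the cone.  Then \<open>U\<close> retracts onto \<open>L\<close>, \<open>V\<close> is contractible,
  \<open>U \<inter> V\<close> is homotopy equivalent to the Moore approximation \<open>Z\<close>, and the inclusion of \<open>U \<inter> V\<close> into
  \<open>U\<close> becomes \<open>f : Z \<rightarrow> L\<close>.  As \<open>f\<close> is injective on homology in every degree, a cycle of positive
  degree in \<open>IX\<close> that is split along the cover can be corrected by a chain in \<open>U \<inter> V\<close> and is homologous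
  to a cycle in \<open>L\<close>.  Below the cut-off degree this cycle comes from \<open>Z\<close> and so bounds in the cone; from
  the cut-off degree on the homology of \<open>Z\<close> vanishes, which makes \<open>H\<^sub>j(L) \<rightarrow> H\<^sub>j(IX)\<close> injective.

  Homotopy invariance and small chains are available for integral chains.  They carry over to real
  coefficients because every real (relative) cycle is a real linear combination of integral ones.
\<close>

section \<open>Linear algebra of real chains\<close>

text \<open>No exact sequence is set up: since \<open>f\<close> is injective on homology in every
  degree, the connecting class of a split cycle vanishes, and what remains can be read off from
  explicit chains. The point-set topology is the heavier half. A homotopy on \<open>IX\<close> has
  to be defined on representatives and descend through two successive quotients; it descends
  continuously because multiplying a quotient map by the compact Hausdorff unit interval gives a
  quotient map again. To pay for this only once, the deformations of \<open>U\<close>, of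
  \<open>V\<close> and of \<open>U \<inter> V\<close> all come from one family that moves points
  only in height, along a profile \<open>\<psi>\<close> fixing both ends of the cone; each is
  defined on all of \<open>IX\<close> and then restricted. From the cut-off degree on, the
  isomorphism is built from \<open>L\<close> to \<open>IX\<close> and inverted at the end, because
  the retraction to \<open>L\<close> is available only on \<open>U\<close>. Degree 0 is treated
  apart: both spaces are path connected, so both reduced groups vanish.\<close>

lemma lookup_map_zero: "f 0 = 0 \<Longrightarrow> Poly_Mapping.lookup (Poly_Mapping.map f c) x = f (Poly_Mapping.lookup c x)"
  by (simp add: Poly_Mapping.map.rep_eq when_def)

lemma keys_map_subset: "Poly_Mapping.keys (Poly_Mapping.map f c) \<subseteq> Poly_Mapping.keys c"
  by (auto simp: in_keys_iff Poly_Mapping.map.rep_eq)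

lemma map_sum_additive:
  assumes "\<And>a b. f (a + b) = f a + f b" "f 0 = 0"
  shows "Poly_Mapping.map f (sum g A) = (\<Sum>x\<in>A. Poly_Mapping.map f (g x))"
proof -
  have "f (sum h A) = (\<Sum>x\<in>A. f (h x))" for h
    by (induction A rule: infinite_finite_induct) (auto simp: assms)
  then show ?thesis
    by (intro poly_mapping_eqI) (simp add: lookup_map_zero assms lookup_sum)
qed

text \<open>With this instance \<open>subspace\<close>, \<open>span\<close> and
  \<open>linear\<close> apply to chains, so that closure arguments replace computations with
  coefficients.\<close>

instantiation poly_mapping :: (type, real_vector) real_vector
begin

definition scaleR_poly_mapping :: "real \<Rightarrow> ('a \<Rightarrow>\<^sub>0 'b) \<Rightarrow> 'a \<Rightarrow>\<^sub>0 'b" where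
  "scaleR_poly_mapping a c = Poly_Mapping.map (scaleR a) c"

instance
  by standard
    (auto simp: scaleR_poly_mapping_def lookup_map_zero lookup_add scaleR_add_right scaleR_add_left
       intro!: poly_mapping_eqI)

end

lemma lookup_scaleR: "Poly_Mapping.lookup (a *\<^sub>R c) x = a *\<^sub>R Poly_Mapping.lookup c x"
  by (simp add: scaleR_poly_mapping_def lookup_map_zero)

lemma keys_scaleR: "Poly_Mapping.keys (a *\<^sub>R c) \<subseteq> Poly_Mapping.keys c"
  by (simp add: scaleR_poly_mapping_def keys_map_subset)

lemma scaleR_single: "a *\<^sub>R Poly_Mapping.single x b = Poly_Mapping.single x (a *\<^sub>R b)"
  by (simp add: scaleR_poly_mapping_def)

lemma chain_scale_eq_scaleR: "chain_scale a c = a *\<^sub>R c"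
  by (simp add: chain_scale_def scaleR_poly_mapping_def real_scaleR_def[abs_def])

text \<open>The real analogue of \<open>frag_extend\<close>; boundary and chain map get their
  linearity from it and can be compared with their integral versions.\<close>

definition lin_extend :: "('a \<Rightarrow> 'b::real_vector) \<Rightarrow> ('a \<Rightarrow>\<^sub>0 real) \<Rightarrow> 'b" where
  "lin_extend F c = (\<Sum>s\<in>Poly_Mapping.keys c. Poly_Mapping.lookup c s *\<^sub>R F s)"

lemma lin_extend_superset:
  "finite A \<Longrightarrow> Poly_Mapping.keys c \<subseteq> A \<Longrightarrow> lin_extend F c = (\<Sum>s\<in>A. Poly_Mapping.lookup c s *\<^sub>R F s)"
  unfolding lin_extend_def by (rule sum.mono_neutral_left) (auto simp: in_keys_iff)

lemma linear_lin_extend: "linear (lin_extend F)"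
proof (rule linearI)
  fix c d :: "'a \<Rightarrow>\<^sub>0 real" and a :: real
  let ?A = "Poly_Mapping.keys c \<union> Poly_Mapping.keys d"
  have "lin_extend F (c + d) = (\<Sum>s\<in>?A. Poly_Mapping.lookup (c + d) s *\<^sub>R F s)"
    by (intro lin_extend_superset keys_add) auto
  also have "\<dots> = (\<Sum>s\<in>?A. Poly_Mapping.lookup c s *\<^sub>R F s) + (\<Sum>s\<in>?A. Poly_Mapping.lookup d s *\<^sub>R F s)"
    by (simp add: lookup_add scaleR_add_left sum.distrib)
  also have "\<dots> = lin_extend F c + lin_extend F d"
    by (intro arg_cong2[of _ _ _ _ "(+)"] lin_extend_superset[symmetric]) auto
  finally show "lin_extend F (c + d) = lin_extend F c + lin_extend F d" .
  show "lin_extend F (a *\<^sub>R c) = a *\<^sub>R lin_extend F c"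
    by (subst lin_extend_superset[OF _ keys_scaleR])
      (simp_all add: lin_extend_def lookup_scaleR scaleR_sum_right)
qed

lemma lin_extend_single [simp]: "lin_extend F (Poly_Mapping.single s a) = a *\<^sub>R F s"
  by (simp add: lin_extend_superset[of "{s}"])

lemma lin_extend_singles: "lin_extend (\<lambda>s. Poly_Mapping.single s 1) c = (c :: 'a \<Rightarrow>\<^sub>0 real)"
  by (intro poly_mapping_eqI)
    (simp add: lin_extend_def scaleR_single lookup_sum lookup_single when_def in_keys_iff)

lemma linear_eq_lin_extend:
  assumes "linear f"
  shows "f c = lin_extend (\<lambda>s. f (Poly_Mapping.single s 1)) (c :: 'a \<Rightarrow>\<^sub>0 real)"
  by (subst lin_extend_singles[symmetric, of c])
    (simp only: lin_extend_def linear_sum[OF assms] linear_scale[OF assms])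

text \<open>Reduces an identity of linear maps to single simplices, each of which is the image of
  some \<open>frag_of s\<close>; there the integral identity can be quoted.\<close>

lemma linear_eq_on_chains:
  assumes "linear f" "linear g" "Poly_Mapping.keys c \<subseteq> S"
    and "\<And>s. s \<in> S \<Longrightarrow> f (Poly_Mapping.single s (1::real)) = g (Poly_Mapping.single s 1)"
  shows "f c = g c"
  unfolding linear_eq_lin_extend[OF assms(1), of c] linear_eq_lin_extend[OF assms(2), of c] lin_extend_def
  using assms(3,4) by (intro sum.cong) auto

lemma lin_extend_mem_subspace:
  assumes "subspace V" "\<And>s. s \<in> Poly_Mapping.keys c \<Longrightarrow> F s \<in> V"
  shows "lin_extend F c \<in> V"
  unfolding lin_extend_def using assms by (intro subspace_sum subspace_scale)

lemma subspace_keys: "subspace {c :: 'a \<Rightarrow>\<^sub>0 real. Poly_Mapping.keys c \<subseteq> S}"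
proof (rule subspaceI)
  show "a *\<^sub>R c \<in> {c. Poly_Mapping.keys c \<subseteq> S}" if "c \<in> {c. Poly_Mapping.keys c \<subseteq> S}" for a and c :: "'a \<Rightarrow>\<^sub>0 real"
    using that keys_scaleR[of a c] by blast
  show "c + d \<in> {c. Poly_Mapping.keys c \<subseteq> S}"
    if "c \<in> {c. Poly_Mapping.keys c \<subseteq> S}" "d \<in> {c. Poly_Mapping.keys c \<subseteq> S}" for c d :: "'a \<Rightarrow>\<^sub>0 real"
    using that keys_add[of c d] by blast
qed simp

lemma real_boundary_eq_lin_extend:
  "real_boundary p =
     (if p = 0 then (\<lambda>_. 0) else lin_extend (\<lambda>s. \<Sum>k\<le>p. Poly_Mapping.single (singular_face p k s) ((-1) ^ k)))"
  by (auto simp: real_boundary_def lin_extend_def fun_eq_iff scaleR_sum_right scaleR_single mult.commute)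

lemma real_chain_map_eq_lin_extend:
  "real_chain_map p g = lin_extend (\<lambda>s. Poly_Mapping.single (simplex_map p g s) 1)"
  by (simp add: real_chain_map_def lin_extend_def fun_eq_iff scaleR_single)

lemma linear_real_boundary: "linear (real_boundary p)"
  by (auto simp: real_boundary_eq_lin_extend linear_lin_extend module_hom_zero)

lemma linear_real_chain_map: "linear (real_chain_map p g)"
  by (simp add: real_chain_map_eq_lin_extend linear_lin_extend)

section \<open>Extension of scalars from integral to real chains\<close>

definition real_of_chain :: "('a \<Rightarrow>\<^sub>0 int) \<Rightarrow> 'a \<Rightarrow>\<^sub>0 real" where
  "real_of_chain z = Poly_Mapping.map of_int z"

lemma lookup_real_of_chain: "Poly_Mapping.lookup (real_of_chain z) s = of_int (Poly_Mapping.lookup z s)"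
  by (simp add: real_of_chain_def lookup_map_zero)

lemma keys_real_of_chain [simp]: "Poly_Mapping.keys (real_of_chain z) = Poly_Mapping.keys z"
  by (auto simp: in_keys_iff lookup_real_of_chain)

lemma real_of_chain_frag_of [simp]: "real_of_chain (frag_of s) = Poly_Mapping.single s 1"
  by (simp add: real_of_chain_def)

lemma real_of_chain_0 [simp]: "real_of_chain 0 = 0"
  by (intro poly_mapping_eqI) (simp add: lookup_real_of_chain)

lemma real_of_chain_add: "real_of_chain (a + b) = real_of_chain a + real_of_chain b"
  by (intro poly_mapping_eqI) (simp add: lookup_real_of_chain lookup_add)

lemma real_of_chain_diff: "real_of_chain (a - b) = real_of_chain a - real_of_chain b"
  by (intro poly_mapping_eqI) (simp add: lookup_real_of_chain lookup_minus)

lemma real_of_chain_cmul: "real_of_chain (frag_cmul n a) = of_int n *\<^sub>R real_of_chain a"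
  by (intro poly_mapping_eqI) (simp add: lookup_real_of_chain lookup_scaleR)

lemma real_of_chain_sum: "real_of_chain (sum f A) = (\<Sum>x\<in>A. real_of_chain (f x))"
  by (intro poly_mapping_eqI) (simp add: lookup_real_of_chain lookup_sum)

lemma real_of_chain_frag_extend:
  "real_of_chain (frag_extend F z) = lin_extend (\<lambda>s. real_of_chain (F s)) (real_of_chain z)"
  by (simp add: frag_extend_def lin_extend_def real_of_chain_sum real_of_chain_cmul lookup_real_of_chain)

lemma real_boundary_real_of_chain:
  "real_boundary p (real_of_chain z) = real_of_chain (chain_boundary p z)"
  by (auto simp: real_boundary_eq_lin_extend chain_boundary_def real_of_chain_frag_extend
      real_of_chain_sum real_of_chain_cmul scaleR_single)

lemma real_chain_map_real_of_chain:
  "real_chain_map p g (real_of_chain z) = real_of_chain (chain_map p g z)"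
  by (simp add: real_chain_map_eq_lin_extend chain_map_def real_of_chain_frag_extend o_def)

lemma real_of_chain_mem_real_chains [simp]:
  "real_of_chain z \<in> real_chains p X \<longleftrightarrow> singular_chain p X z"
  by (simp add: real_chains_def singular_chain_def)

lemma subspace_real_chains: "subspace (real_chains p X)"
  unfolding real_chains_def by (rule subspace_keys)

lemma real_chains_induct:
  assumes "c \<in> real_chains p X" "subspace V"
    and "\<And>s. singular_simplex p X s \<Longrightarrow> Poly_Mapping.single s 1 \<in> V"
  shows "c \<in> V"
  using assms lin_extend_mem_subspace[of V c "\<lambda>s. Poly_Mapping.single s 1"]
  by (auto simp: lin_extend_singles real_chains_def subset_iff)

lemma real_boundary_in_chains:
  assumes "c \<in> real_chains p X" shows "real_boundary p c \<in> real_chains (p - 1) X"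
proof -
  have "c \<in> {c. real_boundary p c \<in> real_chains (p - 1) X}"
    using assms
  proof (rule real_chains_induct)
    show "subspace {c. real_boundary p c \<in> real_chains (p - 1) X}"
      by (rule linear_subspace_linear_preimage[OF linear_real_boundary subspace_real_chains])
    show "Poly_Mapping.single s 1 \<in> {c. real_boundary p c \<in> real_chains (p - 1) X}"
      if "singular_simplex p X s" for s
      using that singular_chain_boundary[of p X "frag_of s"]
      by (simp flip: real_of_chain_frag_of add: real_boundary_real_of_chain singular_chain_of)
  qed
  then show ?thesis by simp
qed

lemma real_boundary_boundary:
  assumes "c \<in> real_chains (Suc p) X" shows "real_boundary p (real_boundary (Suc p) c) = 0"
proof -
  have "(real_boundary p \<circ> real_boundary (Suc p)) c = 0"
  proof (rule linear_eq_on_chains[where f = "_ \<circ> _" and g = "\<lambda>_. 0" and c = c])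
    show "Poly_Mapping.keys c \<subseteq> singular_simplex_set (Suc p) X"
      using assms by (simp add: real_chains_def)
    show "(real_boundary p \<circ> real_boundary (Suc p)) (Poly_Mapping.single s 1) = 0"
      if "s \<in> singular_simplex_set (Suc p) X" for s
      using that chain_boundary_boundary_alt[of p X "frag_of s"]
      by (simp flip: real_of_chain_frag_of add: real_boundary_real_of_chain singular_chain_of)
  qed (intro linear_compose linear_real_boundary module_hom_zero)+
  then show ?thesis by simp
qed

lemma real_chain_map_in_chains:
  assumes "c \<in> real_chains p X" "continuous_map X Y g"
  shows "real_chain_map p g c \<in> real_chains p Y"
proof -
  have "c \<in> {c. real_chain_map p g c \<in> real_chains p Y}"
    using assms(1)
  proof (rule real_chains_induct)
    show "subspace {c. real_chain_map p g c \<in> real_chains p Y}"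
      by (rule linear_subspace_linear_preimage[OF linear_real_chain_map subspace_real_chains])
    show "Poly_Mapping.single s 1 \<in> {c. real_chain_map p g c \<in> real_chains p Y}"
      if "singular_simplex p X s" for s
      using that assms(2) singular_chain_chain_map[of p X "frag_of s" Y g]
      by (simp flip: real_of_chain_frag_of add: real_chain_map_real_of_chain singular_chain_of
          del: chain_map_of)
  qed
  then show ?thesis by simp
qed

lemma real_boundary_chain_map:
  assumes "c \<in> real_chains p X"
  shows "real_boundary p (real_chain_map p g c) = real_chain_map (p - 1) g (real_boundary p c)"
proof -
  have "(real_boundary p \<circ> real_chain_map p g) c = (real_chain_map (p - 1) g \<circ> real_boundary p) c"
  proof (rule linear_eq_on_chains[where f = "_ \<circ> _" and c = c])
    show "Poly_Mapping.keys c \<subseteq> singular_simplex_set p X"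
      using assms by (simp add: real_chains_def)
    show "(real_boundary p \<circ> real_chain_map p g) (Poly_Mapping.single s 1) =
          (real_chain_map (p - 1) g \<circ> real_boundary p) (Poly_Mapping.single s 1)"
      if "s \<in> singular_simplex_set p X" for s
      using that chain_boundary_chain_map[of p X "frag_of s" g]
      by (simp flip: real_of_chain_frag_of
          add: real_boundary_real_of_chain real_chain_map_real_of_chain singular_chain_of
          del: chain_map_of)
  qed (intro linear_compose linear_real_boundary linear_real_chain_map)+
  then show ?thesis by simp
qed

lemma real_chain_map_compose:
  "real_chain_map p (h \<circ> g) c = real_chain_map p h (real_chain_map p g c)"
proof -
  have "real_chain_map p (h \<circ> g) c = (real_chain_map p h \<circ> real_chain_map p g) c"
  proof (rule linear_eq_on_chains[where g = "_ \<circ> _" and c = c, OF _ _ subset_UNIV])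
    show "real_chain_map p (h \<circ> g) (Poly_Mapping.single s 1) =
          (real_chain_map p h \<circ> real_chain_map p g) (Poly_Mapping.single s 1)" for s
      by (simp flip: real_of_chain_frag_of add: real_chain_map_real_of_chain chain_map_compose
          del: chain_map_of)
  qed (intro linear_compose linear_real_chain_map)+
  then show ?thesis by simp
qed

lemma real_chain_map_eq:
  assumes "c \<in> real_chains p X" "\<And>x. x \<in> topspace X \<Longrightarrow> f x = g x"
  shows "real_chain_map p f c = real_chain_map p g c"
  using linear_real_chain_map linear_real_chain_map
proof (rule linear_eq_on_chains)
  show "Poly_Mapping.keys c \<subseteq> singular_simplex_set p X"
    using assms by (simp add: real_chains_def)
  show "real_chain_map p f (Poly_Mapping.single s 1) = real_chain_map p g (Poly_Mapping.single s 1)"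
    if "s \<in> singular_simplex_set p X" for s
    using that assms(2) by (simp add: real_chain_map_eq_lin_extend simplex_map_eq[of p X s f g])
qed

lemma real_chain_map_id:
  assumes "c \<in> real_chains p X" "\<And>x. x \<in> topspace X \<Longrightarrow> f x = x"
  shows "real_chain_map p f c = c"
proof -
  have "real_chain_map p f c = c"
  proof (rule linear_eq_on_chains[where g = "\<lambda>c. c" and c = c])
    show "Poly_Mapping.keys c \<subseteq> singular_simplex_set p X"
      using assms by (simp add: real_chains_def)
    show "real_chain_map p f (Poly_Mapping.single s 1) = Poly_Mapping.single s 1"
      if "s \<in> singular_simplex_set p X" for s
      using that assms(2) by (simp add: real_chain_map_eq_lin_extend simplex_map_id_gen[of p X s f])
  qed (auto intro: linear_real_chain_map module_hom_ident)
  then show ?thesis by simp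
qed

section \<open>Cycles and boundaries as subspaces\<close>

lemma subspace_real_boundaries: "subspace (real_boundaries p X)"
  unfolding real_boundaries_def
  by (rule linear_subspace_image[OF linear_real_boundary subspace_real_chains])

lemma subspace_real_cycles: "subspace (real_cycles p X)"
proof -
  have "subspace (real_chains p X \<inter> {c. real_boundary p c \<in> {0}})"
    by (intro subspace_inter subspace_real_chains linear_subspace_linear_preimage[OF linear_real_boundary]) simp
  then show ?thesis
    by (simp add: real_cycles_def Int_def)
qed

lemma real_boundaries_subset_cycles: "real_boundaries p X \<subseteq> real_cycles p X"
  using real_boundary_in_chains[of _ "Suc p" X] real_boundary_boundary[of _ p X]
  by (auto simp: real_boundaries_def real_cycles_def)

lemma real_of_chain_boundary:
  "singular_relboundary p X {} z \<Longrightarrow> real_of_chain z \<in> real_boundaries p X"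
  unfolding singular_boundary real_boundaries_def
  by (metis image_eqI real_boundary_real_of_chain real_of_chain_mem_real_chains)

section \<open>Real cycles as combinations of integral cycles\<close>

text \<open>Comes from a Hamel basis: \<open>\<phi> b\<close> is the coordinate along the basis
  vector \<open>b\<close> of the reals as a rational vector space, and \<open>I\<close> collects the
  finitely many basis vectors that occur in elements of \<open>K\<close>. Additivity is claimed for
  all reals, since taking boundaries adds coefficients and may leave \<open>K\<close>.\<close>

lemma rational_coordinates:
  assumes "finite K"
  obtains I :: "real set" and \<phi> :: "real \<Rightarrow> real \<Rightarrow> real"
  where "finite I" "\<And>b x y. \<phi> b (x + y) = \<phi> b x + \<phi> b y" "\<And>b x. \<phi> b x \<in> \<rat>"
    "\<And>x. x \<in> K \<Longrightarrow> (\<Sum>b\<in>I. \<phi> b x * b) = x"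
proof -
  interpret Q: vector_space "\<lambda>(q::rat) (x::real). of_rat q * x"
    by standard (auto simp: algebra_simps of_rat_add of_rat_mult)
  define B where "B = Q.extend_basis {}"
  have B: "Q.independent B" "Q.span B = UNIV"
    unfolding B_def by (simp_all add: Q.independent_extend_basis Q.independent_empty)
  define R where "R = Q.representation B"
  define I where "I = (\<Union>x\<in>K. {b. R x b \<noteq> 0})"
  show thesis
  proof
    show fin: "finite I"
      using assms by (auto simp: I_def R_def Q.finite_representation)
    show "real_of_rat (R (x + y) b) = of_rat (R x b) + of_rat (R y b)" for b x y
      using B by (simp add: R_def Q.representation_add of_rat_add)
    show "real_of_rat (R x b) \<in> \<rat>" for b x
      by simp
    show "(\<Sum>b\<in>I. of_rat (R x b) * b) = x" if "x \<in> K" for x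
    proof -
      have "(\<Sum>b\<in>I. of_rat (R x b) * b) = (\<Sum>b | R x b \<noteq> 0. of_rat (R x b) * b)"
        using fin that by (intro sum.mono_neutral_right) (auto simp: I_def)
      also have "\<dots> = x"
        unfolding R_def using B by (intro Q.sum_nonzero_representation_eq) auto
      finally show ?thesis .
    qed
  qed
qed

lemma common_denominator:
  assumes "finite A" "A \<subseteq> \<rat>"
  obtains N :: int where "N > 0" "\<And>a::real. a \<in> A \<Longrightarrow> of_int N * a \<in> \<int>"
proof -
  have "\<exists>N::int. N > 0 \<and> (\<forall>a\<in>A. of_int N * a \<in> \<int>)"
    using assms
  proof (induction A)
    case empty
    then show ?case by (auto intro: exI[of _ 1])
  next
    case (insert x A)
    then obtain N where N: "N > 0" "\<forall>a\<in>A. of_int N * a \<in> \<int>" by auto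
    obtain a b :: int where ab: "b > 0" "x = of_int a / of_int b"
      using insert.prems by (auto elim: Rats_cases')
    have "of_int (N * b) * c \<in> \<int>" if "c \<in> insert x A" for c
    proof (cases "c = x")
      case True
      then have "of_int (N * b) * c = of_int (N * a)" using ab by simp
      then show ?thesis by (metis Ints_of_int)
    next
      case False
      then have "of_int b * (of_int N * c) \<in> \<int>" using N that by auto
      then show ?thesis by (simp add: mult.assoc mult.left_commute)
    qed
    then show ?case using N ab by (intro exI[of _ "N * b"]) auto
  qed
  then show thesis using that by blast
qed

text \<open>The boundary only adds and subtracts coefficients, so any additive change of
  coefficients commutes with it, even one as far from real linearity as a Hamel coordinate.\<close>

lemma real_boundary_map_additive:
  assumes "\<And>a b. f (a + b) = f a + f b"
  shows "real_boundary p (Poly_Mapping.map f c) = Poly_Mapping.map f (real_boundary p c)"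
proof -
  have f0: "f 0 = 0" using assms[of 0 0] by simp
  have fm: "f (- a) = - f a" for a
    using assms[of a "- a"] f0 by (simp add: eq_neg_iff_add_eq_0 add.commute)
  then have fs: "f ((-1) ^ k * a) = (-1) ^ k * f a" for k a
    by (cases "even k") auto
  have map_0: "Poly_Mapping.map f 0 = 0"
    by (intro poly_mapping_eqI) (simp add: lookup_map_zero f0)
  have *: "lin_extend F (Poly_Mapping.map f c) =
             (\<Sum>s\<in>Poly_Mapping.keys c. f (Poly_Mapping.lookup c s) *\<^sub>R F s)" for F :: "_ \<Rightarrow> 'a real_chain"
    by (subst lin_extend_superset[OF finite_keys keys_map_subset]) (simp add: lookup_map_zero f0)
  show ?thesis
    by (simp add: real_boundary_eq_lin_extend * map_0)
      (simp add: lin_extend_def map_sum_additive assms f0 scaleR_sum_right scaleR_single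
        mult.commute[of "f _"] mult.commute[of "Poly_Mapping.lookup _ _"] fs)
qed

text \<open>Coordinates with respect to a basis of the reals over the rationals commute with the boundary,
  so each coordinate of a real cycle is a rational cycle, hence a multiple of an integral one.\<close>

proposition real_relcycle_in_span:
  assumes c: "c \<in> real_chains p X" and bc: "real_boundary p c \<in> real_chains (p - 1) (subtopology X S)"
  shows "c \<in> span (real_of_chain ` {z. singular_relcycle p X S z})"
proof -
  let ?K = "Poly_Mapping.lookup c ` Poly_Mapping.keys c"
  obtain I :: "real set" and \<phi> where I: "finite I" and add: "\<And>b x y. \<phi> b (x + y) = \<phi> b x + \<phi> b y"
    and rat: "\<And>b x. \<phi> b x \<in> \<rat>" and repr: "\<And>x. x \<in> ?K \<Longrightarrow> (\<Sum>b\<in>I. \<phi> b x * b) = x"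
    using rational_coordinates[of ?K] by auto
  have \<phi>0: "\<phi> b 0 = 0" for b using add[of b 0 0] by simp
  have "\<exists>N::int. N > 0 \<and> (\<forall>a\<in>\<phi> b ` ?K. of_int N * a \<in> \<int>)" for b
  proof -
    have "finite (\<phi> b ` ?K)" "\<phi> b ` ?K \<subseteq> \<rat>"
      using rat by auto
    then show ?thesis by (meson common_denominator)
  qed
  then obtain N :: "real \<Rightarrow> int" where N: "\<And>b. N b > 0"
    and NZ: "\<And>b s. s \<in> Poly_Mapping.keys c \<Longrightarrow> of_int (N b) * \<phi> b (Poly_Mapping.lookup c s) \<in> \<int>"
    by (metis image_eqI)
  \<comment> \<open>The floor only changes the type: by \<open>NZ\<close> the number is already an
    integer on the support of \<open>c\<close>.\<close>
  define z where "z b = Poly_Mapping.map (\<lambda>x. \<lfloor>of_int (N b) * \<phi> b x\<rfloor>) c" for b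
  have z: "real_of_chain (z b) = of_int (N b) *\<^sub>R Poly_Mapping.map (\<phi> b) c" for b
  proof (rule poly_mapping_eqI)
    fix s
    show "Poly_Mapping.lookup (real_of_chain (z b)) s = Poly_Mapping.lookup (of_int (N b) *\<^sub>R Poly_Mapping.map (\<phi> b) c) s"
      using NZ[of s b]
      by (cases "s \<in> Poly_Mapping.keys c")
        (simp_all add: z_def lookup_real_of_chain lookup_scaleR lookup_map_zero \<phi>0 in_keys_iff)
  qed
  have "singular_relcycle p X S (z b)" for b
    unfolding singular_relcycle
  proof
    show "singular_chain p X (z b)"
      using c unfolding z_def singular_chain_def real_chains_def
      by (auto intro: subsetD[OF keys_map_subset])
    \<comment> \<open>Taking a coordinate and clearing denominators cannot enlarge a support, so the
      boundary of \<open>z b\<close> stays in \<open>S\<close> along with that of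
      \<open>c\<close>.\<close>
    have "Poly_Mapping.keys (chain_boundary p (z b)) = Poly_Mapping.keys (real_boundary p (real_of_chain (z b)))"
      by (simp add: real_boundary_real_of_chain)
    also have "\<dots> \<subseteq> Poly_Mapping.keys (real_boundary p c)"
      unfolding z linear_scale[OF linear_real_boundary] real_boundary_map_additive[of "\<phi> b", OF add]
      by (rule order_trans[OF keys_scaleR keys_map_subset])
    finally show "singular_chain (p - 1) (subtopology X S) (chain_boundary p (z b))"
      using bc unfolding singular_chain_def real_chains_def by auto
  qed
  \<comment> \<open>The weight \<open>b / N b\<close> cancels the denominator and restores the basis
    vector, so the sum rebuilds each coefficient of \<open>c\<close> from its coordinates.\<close>
  then have "(\<Sum>b\<in>I. (b / of_int (N b)) *\<^sub>R real_of_chain (z b)) \<in> span (real_of_chain ` {z. singular_relcycle p X S z})"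
    by (intro span_sum span_scale span_base) auto
  moreover have "(\<Sum>b\<in>I. (b / of_int (N b)) *\<^sub>R real_of_chain (z b)) = c"
  proof (rule poly_mapping_eqI)
    fix s
    have "N b \<noteq> 0" for b using N[of b] by simp
    then have "Poly_Mapping.lookup (\<Sum>b\<in>I. (b / of_int (N b)) *\<^sub>R real_of_chain (z b)) s =
               (\<Sum>b\<in>I. \<phi> b (Poly_Mapping.lookup c s) * b)"
      by (simp add: lookup_sum lookup_scaleR z lookup_map_zero \<phi>0 mult.commute)
    also have "\<dots> = Poly_Mapping.lookup c s"
      using repr \<phi>0 by (cases "s \<in> Poly_Mapping.keys c") (auto simp: in_keys_iff)
    finally show "Poly_Mapping.lookup (\<Sum>b\<in>I. (b / of_int (N b)) *\<^sub>R real_of_chain (z b)) s = Poly_Mapping.lookup c s" .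
  qed
  ultimately show ?thesis by simp
qed

text \<open>The form in which extension of scalars is applied: a property that cuts out a subspace
  has to be verified for integral relative cycles only.\<close>

lemma real_relcycle_induct:
  assumes "c \<in> real_chains p X" "real_boundary p c \<in> real_chains (p - 1) (subtopology X S)" "subspace V"
    and "\<And>z. singular_relcycle p X S z \<Longrightarrow> real_of_chain z \<in> V"
  shows "c \<in> V"
  using span_minimal[OF _ assms(3), of "real_of_chain ` {z. singular_relcycle p X S z}"]
    real_relcycle_in_span[OF assms(1,2)] assms(4) by blast

lemma real_cycle_induct:
  assumes "c \<in> real_cycles p X" "subspace V"
    and "\<And>z. singular_relcycle p X {} z \<Longrightarrow> real_of_chain z \<in> V"
  shows "c \<in> V"
proof (rule real_relcycle_induct[OF _ _ assms(2,3)])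
  show "c \<in> real_chains p X" "real_boundary p c \<in> real_chains (p - 1) (subtopology X {})"
    using assms(1) by (simp_all add: real_cycles_def subspace_0[OF subspace_real_chains])
qed

section \<open>Homotopy invariance and small chains with real coefficients\<close>

lemma homotopic_imp_homologous_real:
  assumes h: "homotopic_with (\<lambda>_. True) X Y f g" and c: "c \<in> real_cycles p X"
  shows "real_chain_map p f c - real_chain_map p g c \<in> real_boundaries p Y"
proof -
  have "c \<in> {c. real_chain_map p f c - real_chain_map p g c \<in> real_boundaries p Y}"
    using c
  proof (rule real_cycle_induct)
    show "subspace {c. real_chain_map p f c - real_chain_map p g c \<in> real_boundaries p Y}"
      by (intro linear_subspace_linear_preimage linear_compose_sub linear_real_chain_map subspace_real_boundaries)
    fix z assume "singular_relcycle p X {} z"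
    \<comment> \<open>The integral theorem is about pairs; with empty subspaces its side condition
      is vacuous.\<close>
    moreover have "homotopic_with (\<lambda>h. h \<in> {} \<rightarrow> {}) X Y f g" using h by simp
    ultimately have "homologous_rel p Y {} (chain_map p f z) (chain_map p g z)"
      using homotopic_imp_homologous_rel_chain_maps by blast
    then show "real_of_chain z \<in> {c. real_chain_map p f c - real_chain_map p g c \<in> real_boundaries p Y}"
      using real_of_chain_boundary[of p Y "chain_map p f z - chain_map p g z"]
      by (simp add: homologous_rel_def real_chain_map_real_of_chain real_of_chain_diff)
  qed
  then show ?thesis by simp
qed

text \<open>The contraction makes a cycle homologous to its image in a single point, where every
  cycle of positive degree bounds.\<close>

lemma contractible_real_boundary:
  assumes "contractible_space Y" "p > 0" "c \<in> real_cycles p Y"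
  shows "c \<in> real_boundaries p Y"
  using assms(3) subspace_real_boundaries
proof (rule real_cycle_induct)
  fix z assume z: "singular_relcycle p Y {} z"
  obtain a where a: "homotopic_with (\<lambda>_. True) Y Y id (\<lambda>_. a)"
    using assms(1) by (auto simp: contractible_space_def)
  then have cont: "continuous_map Y Y (\<lambda>_. a)"
    by (metis homotopic_with_imp_continuous_maps)
  show "real_of_chain z \<in> real_boundaries p Y"
  proof (rule real_of_chain_boundary, cases "topspace Y = {}")
    \<comment> \<open>The empty space counts as contractible; this case arises for \<open>V\<close>
      when the Moore approximation is empty.\<close>
    case True
    then show "singular_relboundary p Y {} z"
      using z by (simp add: singular_cycle singular_chain_empty)
  next
    case False
    then have aY: "a \<in> topspace Y"
      using cont by (auto simp: continuous_map_def)
    then have top: "topspace (subtopology Y {a}) = {a}" by auto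
    have "homotopic_with (\<lambda>h. h \<in> {} \<rightarrow> {}) Y Y id (\<lambda>_. a)" using a by simp
    then have "homologous_rel p Y {} (chain_map p id z) (chain_map p (\<lambda>_. a) z)"
      using z by (rule homotopic_imp_homologous_rel_chain_maps)
    moreover have "chain_map p id z = z"
      using z by (auto simp: singular_cycle intro: chain_map_ident)
    moreover have "singular_relcycle p (subtopology Y {a}) {} (chain_map p (\<lambda>_. a) z)"
      using z by (rule singular_relcycle_chain_map) (use cont in \<open>auto simp: continuous_map_in_subtopology\<close>)
    then have "singular_relboundary p (subtopology Y {a}) {} (chain_map p (\<lambda>_. a) z)"
      using singular_boundary_eq_cycle_singleton[OF top] assms(2) by simp
    then have "singular_relboundary p Y {} (chain_map p (\<lambda>_. a) z)"
      using singular_boundary_mono[of "{a}" UNIV p Y] by simp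
    ultimately show "singular_relboundary p Y {} z"
      using singular_relboundary_add[of p Y "{}" "z - chain_map p (\<lambda>_. a) z" "chain_map p (\<lambda>_. a) z"]
      by (simp add: homologous_rel_def)
  qed
qed

text \<open>Chains that split in this way form a subspace, so the integral theorem on small chains
  suffices. The remainder \<open>e\<close> in \<open>S\<close> accommodates chains that are not
  cycles: in \<open>boundary_in_L\<close> the chain merely has its boundary in
  \<open>U\<close>.\<close>

lemma small_real_chain:
  assumes "openin X U" "openin X V" "topspace X \<subseteq> U \<union> V"
    and c: "c \<in> real_chains p X" and bc: "real_boundary p c \<in> real_chains (p - 1) (subtopology X S)"
  obtains u v d e where "u \<in> real_chains p (subtopology X U)" "v \<in> real_chains p (subtopology X V)"
    "d \<in> real_chains (Suc p) X" "e \<in> real_chains p (subtopology X S)"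
    "c = u + v + real_boundary (Suc p) d + e"
proof -
  define W1 where "W1 = {u + v | u v. u \<in> real_chains p (subtopology X U) \<and> v \<in> real_chains p (subtopology X V)}"
  define W2 where "W2 = {w + d | w d. w \<in> W1 \<and> d \<in> real_boundaries p X}"
  define W3 where "W3 = {w + e | w e. w \<in> W2 \<and> e \<in> real_chains p (subtopology X S)}"
  have W1: "subspace W1"
    unfolding W1_def by (intro subspace_sums subspace_real_chains)
  have W3: "subspace W3"
    unfolding W3_def W2_def by (intro subspace_sums subspace_real_chains subspace_real_boundaries W1)
  have "c \<in> W3"
    using c bc W3
  proof (rule real_relcycle_induct)
    fix z assume z: "singular_relcycle p X S z"
    obtain z' where z': "singular_relcycle p X S z'" "homologous_rel p X S z z'"
      and small: "\<And>s. s \<in> Poly_Mapping.keys z' \<Longrightarrow> \<exists>T\<in>{U, V}. s \<in> standard_simplex p \<rightarrow> T"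
      using small_homologous_rel_relcycle_exists[of "{U, V}" X p S z] assms z by auto
    obtain d e where d: "singular_chain (Suc p) X d" and e: "singular_chain p (subtopology X S) e"
      and zz: "chain_boundary (Suc p) d + e = z - z'"
      using z'(2) by (auto simp: homologous_rel_def singular_relboundary)
    \<comment> \<open>Each simplex of \<open>z'\<close> lies as a whole in \<open>U\<close> or in
      \<open>V\<close>, so \<open>z'\<close> can be assembled inside \<open>W1\<close> one simplex
      at a time.\<close>
    have "lin_extend (\<lambda>s. Poly_Mapping.single s 1) (real_of_chain z') \<in> W1"
    proof (rule lin_extend_mem_subspace[OF W1])
      fix s assume "s \<in> Poly_Mapping.keys (real_of_chain z')"
      then have s: "s \<in> Poly_Mapping.keys z'" by simp
      then have "singular_simplex p X s"
        using z'(1) by (auto simp: singular_relcycle singular_chain_def)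
      then have "singular_simplex p (subtopology X U) s \<or> singular_simplex p (subtopology X V) s"
        using small[OF s] by (auto simp: singular_simplex_subtopology)
      then show "Poly_Mapping.single s 1 \<in> W1"
      proof
        assume "singular_simplex p (subtopology X U) s"
        then show ?thesis unfolding W1_def
          by (intro CollectI exI[of _ "Poly_Mapping.single s 1"] exI[of _ 0]) (auto simp: real_chains_def)
      next
        assume "singular_simplex p (subtopology X V) s"
        then show ?thesis unfolding W1_def
          by (intro CollectI exI[of _ "Poly_Mapping.single s 1"] exI[of _ 0]) (auto simp: real_chains_def)
      qed
    qed
    then have w: "real_of_chain z' \<in> W1" by (simp add: lin_extend_singles)
    have "z = z' + chain_boundary (Suc p) d + e" using zz by (simp add: algebra_simps)
    then have "real_of_chain z = (real_of_chain z' + real_boundary (Suc p) (real_of_chain d)) + real_of_chain e"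
      by (simp add: real_of_chain_add real_boundary_real_of_chain)
    moreover have "real_boundary (Suc p) (real_of_chain d) \<in> real_boundaries p X"
      using d by (simp add: real_boundaries_def)
    moreover have "real_of_chain e \<in> real_chains p (subtopology X S)"
      using e by simp
    ultimately show "real_of_chain z \<in> W3"
      using w unfolding W3_def W2_def by blast
  qed
  then show thesis
    using that unfolding W3_def W2_def W1_def real_boundaries_def by blast
qed

section \<open>Reduced homology in degree 0\<close>

text \<open>When the coefficients sum to zero, subtracting a fixed \<open>s0\<close> from every
  simplex does not change \<open>c\<close>, and a path makes each difference \<open>s - s0\<close> a
  boundary.\<close>

lemma path_connected_reduced_boundary:
  assumes "path_connected_space X" "c \<in> reduced_real_cycles 0 X"
  shows "c \<in> real_boundaries 0 X"
proof (cases "c = 0")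
  case True
  then show ?thesis by (simp add: subspace_0 subspace_real_boundaries)
next
  case False
  have keys: "singular_simplex 0 X s" if "s \<in> Poly_Mapping.keys c" for s
    using assms(2) that by (auto simp: reduced_real_cycles_def real_cycles_def real_chains_def)
  obtain s0 where s0: "s0 \<in> Poly_Mapping.keys c"
    using False by (metis keys_eq_empty ex_in_conv)
  have "lin_extend (\<lambda>s. Poly_Mapping.single s 1 - Poly_Mapping.single s0 1) c \<in> real_boundaries 0 X"
  proof (rule lin_extend_mem_subspace[OF subspace_real_boundaries])
    fix s assume "s \<in> Poly_Mapping.keys c"
    then have "homologous_rel 0 X {} (frag_of s) (frag_of s0)"
      using iso_integer_zeroth_homology_group_aux[OF assms(1) keys keys[OF s0]] by blast
    then show "Poly_Mapping.single s 1 - Poly_Mapping.single s0 1 \<in> real_boundaries 0 X"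
      using real_of_chain_boundary[of 0 X "frag_of s - frag_of s0"]
      by (simp add: homologous_rel_def real_of_chain_diff)
  qed
  moreover have "lin_extend (\<lambda>s. Poly_Mapping.single s 1 - Poly_Mapping.single s0 1) c = c"
  proof -
    have "(\<Sum>s\<in>Poly_Mapping.keys c. Poly_Mapping.lookup c s) = 0"
      using assms(2) by (simp add: reduced_real_cycles_def)
    then have "(\<Sum>s\<in>Poly_Mapping.keys c. Poly_Mapping.lookup c s *\<^sub>R Poly_Mapping.single s0 1) = (0 :: 'a real_chain)"
      by (simp flip: scaleR_sum_left)
    then show ?thesis
      using lin_extend_singles[of c]
      by (simp add: lin_extend_def scaleR_diff_right sum_subtractf)
  qed
  ultimately show ?thesis by simp
qed

section \<open>Chains in subspaces and under continuous maps\<close>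

text \<open>Removes the remainder of \<open>small_real_chain\<close> in the absolute case, where it
  lies in the empty subspace.\<close>

lemma real_chains_trivial_topology [simp]: "real_chains p trivial_topology = {0}"
proof -
  have "\<not> singular_simplex p trivial_topology s" for s :: "(nat \<Rightarrow> real) \<Rightarrow> 'a"
    by (rule singular_simplex_empty) simp
  then have "singular_simplex_set p (trivial_topology :: 'a topology) = {}" by blast
  then show ?thesis
    by (simp only: real_chains_def subset_empty keys_eq_empty singleton_conv)
qed

lemma real_chains_mono: "S \<subseteq> T \<Longrightarrow> real_chains p (subtopology X S) \<subseteq> real_chains p (subtopology X T)"
  using singular_simplex_mono unfolding real_chains_def by blast

lemma real_chains_subtopology: "real_chains p (subtopology X S) \<subseteq> real_chains p X"
  using real_chains_mono[of S UNIV p X] by simp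

text \<open>Membership in a subspace is tested simplex by simplex; this puts the boundary common to
  both halves of a split chain into \<open>U \<inter> V\<close>.\<close>

lemma real_chains_Int:
  "c \<in> real_chains p (subtopology X S) \<Longrightarrow> c \<in> real_chains p (subtopology X T) \<Longrightarrow>
   c \<in> real_chains p (subtopology X (S \<inter> T))"
  unfolding real_chains_def by (auto simp: singular_simplex_subtopology subset_iff)

lemma real_boundaries_mono: "S \<subseteq> T \<Longrightarrow> real_boundaries p (subtopology X S) \<subseteq> real_boundaries p (subtopology X T)"
  unfolding real_boundaries_def by (intro image_mono real_chains_mono)

lemma real_boundaries_subtopology: "real_boundaries p (subtopology X S) \<subseteq> real_boundaries p X"
  unfolding real_boundaries_def by (intro image_mono real_chains_subtopology)

lemma real_cycles_mono: "S \<subseteq> T \<Longrightarrow> real_cycles p (subtopology X S) \<subseteq> real_cycles p (subtopology X T)"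
  unfolding real_cycles_def using real_chains_mono by blast

lemma real_chain_map_cycle:
  "c \<in> real_cycles p X \<Longrightarrow> continuous_map X Y g \<Longrightarrow> real_chain_map p g c \<in> real_cycles p Y"
  using real_boundary_chain_map[of c p X g] real_chain_map_in_chains[of c p X Y g]
  by (simp add: real_cycles_def linear_0[OF linear_real_chain_map])

lemma real_chain_map_boundary:
  assumes "c \<in> real_boundaries p X" "continuous_map X Y g"
  shows "real_chain_map p g c \<in> real_boundaries p Y"
proof -
  obtain d where "d \<in> real_chains (Suc p) X" "c = real_boundary (Suc p) d"
    using assms(1) by (auto simp: real_boundaries_def)
  then show ?thesis
    using real_boundary_chain_map[of d "Suc p" X g] real_chain_map_in_chains[OF _ assms(2), of d "Suc p"]
    unfolding real_boundaries_def by (metis diff_Suc_1 image_eqI)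
qed

section \<open>Quotients of chain spaces\<close>

lemma coset_eq_iff:
  assumes "subspace (B :: 'a::real_vector set)"
  shows "(+) z ` B = (+) w ` B \<longleftrightarrow> z - w \<in> B"
proof
  assume eq: "(+) z ` B = (+) w ` B"
  have "z \<in> (+) z ` B" using subspace_0[OF assms] by (auto intro!: image_eqI[of _ _ 0])
  then show "z - w \<in> B" using eq by auto
next
  assume zw: "z - w \<in> B"
  have "x \<in> (+) w ` B" if x: "x \<in> (+) z ` B" and zw: "z - w \<in> B" for x z w
  proof -
    obtain b where "b \<in> B" "x = z + b" using x by blast
    then show ?thesis
      using subspace_add[OF assms zw] by (intro image_eqI[of _ _ "z - w + b"]) auto
  qed
  moreover have "w - z \<in> B" using subspace_neg[OF assms zw] by simp
  ultimately show "(+) z ` B = (+) w ` B" using zw by blast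
qed

lemma carrier_chain_quotient: "carrier (chain_quotient Z B) = (\<lambda>z. (+) z ` B) ` Z"
  and zero_chain_quotient: "\<zero>\<^bsub>chain_quotient Z B\<^esub> = B"
  by (simp_all add: chain_quotient_def)

lemma add_chain_quotient:
  assumes "subspace B"
  shows "(+) z ` B \<oplus>\<^bsub>chain_quotient Z B\<^esub> (+) w ` B = (+) (z + w) ` B"
proof -
  have "{c + d |c d. c \<in> (+) z ` B \<and> d \<in> (+) w ` B} = (+) (z + w) ` B"
  proof safe
    fix b b' assume "b \<in> B" "b' \<in> B"
    then show "z + b + (w + b') \<in> (+) (z + w) ` B"
      using subspace_add[OF assms] by (intro image_eqI[of _ _ "b + b'"]) (auto simp: algebra_simps)
  next
    fix b assume "b \<in> B"
    then show "\<exists>c d. z + w + b = c + d \<and> c \<in> (+) z ` B \<and> d \<in> (+) w ` B"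
      using subspace_0[OF assms] by (intro exI[of _ "z + b"] exI[of _ "w + 0"]) (auto simp: algebra_simps)
  qed
  then show ?thesis by (simp add: chain_quotient_def)
qed

lemma smult_chain_quotient:
  assumes "subspace B"
  shows "a \<odot>\<^bsub>chain_quotient Z B\<^esub> ((+) z ` B) = (+) (a *\<^sub>R z) ` B"
proof -
  have "{a *\<^sub>R c + b |c b. c \<in> (+) z ` B \<and> b \<in> B} = (+) (a *\<^sub>R z) ` B"
  proof safe
    fix b b' assume "b \<in> B" "b' \<in> B"
    then show "a *\<^sub>R (z + b) + b' \<in> (+) (a *\<^sub>R z) ` B"
      using subspace_add[OF assms subspace_scale[OF assms]]
      by (intro image_eqI[of _ _ "a *\<^sub>R b + b'"]) (auto simp: algebra_simps)
  next
    fix b assume "b \<in> B"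
    then show "\<exists>c b'. a *\<^sub>R z + b = a *\<^sub>R c + b' \<and> c \<in> (+) z ` B \<and> b' \<in> B"
      using subspace_0[OF assms] by (intro exI[of _ "z + 0"] exI[of _ b]) auto
  qed
  then show ?thesis by (simp add: chain_quotient_def chain_scale_eq_scaleR)
qed

lemma zero_module_chain_quotient:
  assumes "subspace Z" "subspace B" "B \<subseteq> Z"
  shows "zero_module (chain_quotient Z B) \<longleftrightarrow> Z \<subseteq> B"
proof -
  have B: "(+) z ` B = B \<longleftrightarrow> z \<in> B" for z
    using coset_eq_iff[OF assms(2), of z 0] by simp
  have "F ` Z = {B} \<longleftrightarrow> (\<forall>z\<in>Z. F z = B)" for F :: "'a real_chain \<Rightarrow> 'a real_chain set"
    using subspace_0[OF assms(1)] by (auto simp: image_def)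
  then show ?thesis
    by (auto simp: zero_module_def carrier_chain_quotient zero_chain_quotient B)
qed

text \<open>Bijectivity is phrased for representatives modulo boundaries, so that it can be checked
  by moving chains. The displayed map sends the coset of \<open>z\<close> to that of
  \<open>T z\<close>, because adding all of \<open>B'\<close> absorbs the image of
  \<open>B\<close>.\<close>

lemma linear_iso_chain_quotient:
  assumes Z: "subspace Z" "subspace B" and Z': "subspace B'"
    and T: "linear T" "T ` Z \<subseteq> Z'" "T ` B \<subseteq> B'"
    and inj: "\<And>z. z \<in> Z \<Longrightarrow> T z \<in> B' \<Longrightarrow> z \<in> B"
    and surj: "\<And>w. w \<in> Z' \<Longrightarrow> \<exists>z\<in>Z. w - T z \<in> B'"
  shows "linear_iso (chain_quotient Z B) (chain_quotient Z' B') (\<lambda>C. {T c + b |c b. c \<in> C \<and> b \<in> B'})"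
proof -
  define h where "h C = {T c + b |c b. c \<in> C \<and> b \<in> B'}" for C
  have h: "h ((+) z ` B) = (+) (T z) ` B'" for z
    unfolding h_def
  proof safe
    fix b b' assume "b \<in> B" "b' \<in> B'"
    then show "T (z + b) + b' \<in> (+) (T z) ` B'"
      using T subspace_add[OF Z'] by (intro image_eqI[of _ _ "T b + b'"]) (auto simp: linear_add algebra_simps)
  next
    fix b assume "b \<in> B'"
    then show "\<exists>c b'. T z + b = T c + b' \<and> c \<in> (+) z ` B \<and> b' \<in> B'"
      using subspace_0[OF Z(2)] by (intro exI[of _ "z + 0"] exI[of _ b]) auto
  qed
  have "bij_betw h (carrier (chain_quotient Z B)) (carrier (chain_quotient Z' B'))"
    unfolding bij_betw_def carrier_chain_quotient
  proof
    show "inj_on h ((\<lambda>z. (+) z ` B) ` Z)"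
    proof (rule inj_onI, clarify)
      fix z w assume "z \<in> Z" "w \<in> Z" "h ((+) z ` B) = h ((+) w ` B)"
      then have "T (z - w) \<in> B'"
        by (simp add: h coset_eq_iff Z' linear_diff[OF T(1)])
      then show "(+) z ` B = (+) w ` B"
        using \<open>z \<in> Z\<close> \<open>w \<in> Z\<close> inj subspace_diff[OF Z(1)] by (simp add: coset_eq_iff Z)
    qed
    show "h ` (\<lambda>z. (+) z ` B) ` Z = (\<lambda>z. (+) z ` B') ` Z'"
    proof safe
      fix z assume "z \<in> Z"
      then show "h ((+) z ` B) \<in> (\<lambda>z. (+) z ` B') ` Z'"
        unfolding h using T(2) by blast
    next
      fix w assume "w \<in> Z'"
      then obtain z where "z \<in> Z" "w - T z \<in> B'" using surj by blast
      then have "(+) w ` B' = h ((+) z ` B)"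
        by (simp add: h coset_eq_iff Z')
      then show "(+) w ` B' \<in> h ` (\<lambda>z. (+) z ` B) ` Z"
        using \<open>z \<in> Z\<close> by blast
    qed
  qed
  then show ?thesis
    unfolding linear_iso_def h_def[symmetric]
    by (auto simp: carrier_chain_quotient add_chain_quotient smult_chain_quotient Z Z' h
        linear_add[OF T(1)] linear_scale[OF T(1)])
qed

text \<open>\<open>linear_iso\<close> speaks about bare records, so closure of the carrier has to be
  assumed before the inverse can be evaluated on sums and multiples.\<close>

lemma linear_iso_inverse:
  assumes "linear_iso M N h"
    and closed: "\<And>x y. x \<in> carrier M \<Longrightarrow> y \<in> carrier M \<Longrightarrow> x \<oplus>\<^bsub>M\<^esub> y \<in> carrier M"
      "\<And>a x. x \<in> carrier M \<Longrightarrow> a \<odot>\<^bsub>M\<^esub> x \<in> carrier M"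
  shows "linear_iso N M (inv_into (carrier M) h)"
proof -
  let ?g = "inv_into (carrier M) h"
  have bij: "bij_betw h (carrier M) (carrier N)"
    and h: "\<And>x y. x \<in> carrier M \<Longrightarrow> y \<in> carrier M \<Longrightarrow> h (x \<oplus>\<^bsub>M\<^esub> y) = h x \<oplus>\<^bsub>N\<^esub> h y"
      "\<And>a x. x \<in> carrier M \<Longrightarrow> h (a \<odot>\<^bsub>M\<^esub> x) = a \<odot>\<^bsub>N\<^esub> h x"
    using assms(1) by (auto simp: linear_iso_def)
  have g: "?g u \<in> carrier M" "h (?g u) = u" if "u \<in> carrier N" for u
    using that bij by (auto simp: bij_betw_def inv_into_into f_inv_into_f)
  have gh: "?g (h x) = x" if "x \<in> carrier M" for x
    using that bij by (simp add: bij_betw_def)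
  have "?g (u \<oplus>\<^bsub>N\<^esub> v) = ?g u \<oplus>\<^bsub>M\<^esub> ?g v" if "u \<in> carrier N" "v \<in> carrier N" for u v
    using gh[OF closed(1)[OF g(1) g(1)], OF that] h(1)[OF g(1) g(1), OF that] by (simp add: g(2) that)
  moreover have "?g (a \<odot>\<^bsub>N\<^esub> u) = a \<odot>\<^bsub>M\<^esub> ?g u" if "u \<in> carrier N" for a u
    using gh[OF closed(2)[OF g(1)], OF that] h(2)[OF g(1), OF that] by (simp add: g(2) that)
  ultimately show ?thesis
    unfolding linear_iso_def using bij_betw_inv_into[OF bij] by blast
qed

lemma linearly_isomorphic_chain_quotient_sym:
  assumes "linearly_isomorphic (chain_quotient Z B) N" "subspace Z" "subspace B"
  shows "linearly_isomorphic N (chain_quotient Z B)"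
proof -
  obtain h where h: "linear_iso (chain_quotient Z B) N h"
    using assms(1) by (auto simp: linearly_isomorphic_def)
  have "linear_iso N (chain_quotient Z B) (inv_into (carrier (chain_quotient Z B)) h)"
    by (rule linear_iso_inverse[OF h])
      (auto simp: carrier_chain_quotient add_chain_quotient smult_chain_quotient assms
        intro!: imageI subspace_add[OF assms(2)] subspace_scale[OF assms(2)])
  then show ?thesis by (auto simp: linearly_isomorphic_def)
qed

text \<open>Unpacks the Moore condition for use with chains: injectivity and surjectivity on cosets
  become solvability modulo boundaries.\<close>

lemma real_hom_induced_iso_imp:
  assumes "linear_iso (real_homology m Z) (real_homology m L) (real_hom_induced m L f)"
    and "continuous_map Z L f"
  shows real_hom_induced_inj: "\<And>z. z \<in> real_cycles m Z \<Longrightarrow> real_chain_map m f z \<in> real_boundaries m L \<Longrightarrow>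
      z \<in> real_boundaries m Z"
    and real_hom_induced_surj: "\<And>y. y \<in> real_cycles m L \<Longrightarrow>
      \<exists>z\<in>real_cycles m Z. y - real_chain_map m f z \<in> real_boundaries m L"
proof -
  let ?h = "real_hom_induced m L f" and ?B = "real_boundaries m Z" and ?B' = "real_boundaries m L"
  have bij: "bij_betw ?h ((\<lambda>z. (+) z ` ?B) ` real_cycles m Z) ((\<lambda>z. (+) z ` ?B') ` real_cycles m L)"
    using assms(1) by (simp add: linear_iso_def real_homology_def carrier_chain_quotient)
  have h: "?h ((+) z ` ?B) = (+) (real_chain_map m f z) ` ?B'" for z
    unfolding real_hom_induced_def
  proof safe
    fix b b' assume "b \<in> ?B" "b' \<in> ?B'"
    then show "real_chain_map m f (z + b) + b' \<in> (+) (real_chain_map m f z) ` ?B'"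
      using subspace_add[OF subspace_real_boundaries real_chain_map_boundary[OF _ assms(2)], of b m b']
      by (intro image_eqI[of _ _ "real_chain_map m f b + b'"])
        (simp_all add: linear_add[OF linear_real_chain_map] add.assoc)
  next
    fix b assume "b \<in> ?B'"
    then show "\<exists>c b'. real_chain_map m f z + b = real_chain_map m f c + b' \<and> c \<in> (+) z ` ?B \<and> b' \<in> ?B'"
      using subspace_0[OF subspace_real_boundaries]
      by (intro exI[of _ "z + 0"] exI[of _ b]) (auto intro!: image_eqI[of _ _ 0])
  qed
  show "z \<in> ?B" if "z \<in> real_cycles m Z" "real_chain_map m f z \<in> ?B'" for z
  proof -
    have "?h ((+) z ` ?B) = ?h ((+) 0 ` ?B)"
      unfolding h coset_eq_iff[OF subspace_real_boundaries]
      using that(2) by (simp add: linear_0[OF linear_real_chain_map])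
    moreover have "0 \<in> real_cycles m Z"
      by (simp add: subspace_0 subspace_real_cycles)
    ultimately have "(+) z ` ?B = (+) 0 ` ?B"
      using bij_betw_imp_inj_on[OF bij] that(1) by (meson imageI inj_onD)
    then show ?thesis
      unfolding coset_eq_iff[OF subspace_real_boundaries] by simp
  qed
  show "\<exists>z\<in>real_cycles m Z. y - real_chain_map m f z \<in> ?B'" if "y \<in> real_cycles m L" for y
  proof -
    have "(+) y ` ?B' \<in> ?h ` (\<lambda>z. (+) z ` ?B) ` real_cycles m Z"
      using bij that by (simp add: bij_betw_def)
    then obtain z where "z \<in> real_cycles m Z" "(+) y ` ?B' = (+) (real_chain_map m f z) ` ?B'"
      using h by auto
    then show ?thesis
      unfolding coset_eq_iff[OF subspace_real_boundaries] by blast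
  qed
qed

section \<open>A Mayer-Vietoris argument\<close>

text \<open>Isolates what homology sees of the gluing. The equations \<open>\<rho>_i\<close> and
  \<open>\<rho>_\<alpha>\<close> hold pointwise and so give equal chains, whereas the homotopies
  \<open>i_\<rho>\<close> and \<open>\<alpha>_\<beta>\<close> give equality of cycles only up to
  boundaries.\<close>

locale homotopy_cofibre_cover =
  fixes X :: "'x topology" and U V :: "'x set" and L :: "'a topology" and Z :: "'b topology"
    and i :: "'a \<Rightarrow> 'x" and \<rho> :: "'x \<Rightarrow> 'a" and \<alpha> :: "'b \<Rightarrow> 'x" and \<beta> :: "'x \<Rightarrow> 'b" and f :: "'b \<Rightarrow> 'a"
  assumes openU: "openin X U" and openV: "openin X V" and cover: "topspace X \<subseteq> U \<union> V"
    and i: "continuous_map L (subtopology X U) i"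
    and \<rho>: "continuous_map (subtopology X U) L \<rho>"
    and \<rho>_i: "\<And>x. x \<in> topspace L \<Longrightarrow> \<rho> (i x) = x"
    and i_\<rho>: "homotopic_with (\<lambda>_. True) (subtopology X U) (subtopology X U) id (i \<circ> \<rho>)"
    and \<alpha>: "continuous_map Z (subtopology X (U \<inter> V)) \<alpha>"
    and \<beta>: "continuous_map (subtopology X (U \<inter> V)) Z \<beta>"
    and \<alpha>_\<beta>: "homotopic_with (\<lambda>_. True) (subtopology X (U \<inter> V)) (subtopology X (U \<inter> V)) id (\<alpha> \<circ> \<beta>)"
    and \<rho>_\<alpha>: "\<And>z. z \<in> topspace Z \<Longrightarrow> \<rho> (\<alpha> z) = f z"
    and contr: "contractible_space (subtopology X V)"
begin

lemma U_retract:
  assumes "c \<in> real_cycles p (subtopology X U)"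
  shows "c - real_chain_map p i (real_chain_map p \<rho> c) \<in> real_boundaries p (subtopology X U)"
  using homotopic_imp_homologous_real[OF i_\<rho> assms] real_chain_map_id[of c p "subtopology X U" id] assms
  by (simp add: real_chain_map_compose real_cycles_def)

lemma Int_retract:
  assumes "c \<in> real_cycles p (subtopology X (U \<inter> V))"
  shows "c - real_chain_map p \<alpha> (real_chain_map p \<beta> c) \<in> real_boundaries p (subtopology X (U \<inter> V))"
  using homotopic_imp_homologous_real[OF \<alpha>_\<beta> assms] real_chain_map_id[of c p "subtopology X (U \<inter> V)" id] assms
  by (simp add: real_chain_map_compose real_cycles_def)

lemma \<rho>_\<alpha>_chain: "c \<in> real_chains p Z \<Longrightarrow> real_chain_map p \<rho> (real_chain_map p \<alpha> c) = real_chain_map p f c"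
  by (simp add: \<rho>_\<alpha> real_chain_map_eq[of c p Z "\<rho> \<circ> \<alpha>" f] flip: real_chain_map_compose)

lemma Int_boundary:
  assumes e: "e \<in> real_cycles m (subtopology X (U \<inter> V))" and \<beta>e: "real_chain_map m \<beta> e \<in> real_boundaries m Z"
  shows "e \<in> real_boundaries m (subtopology X (U \<inter> V))"
  using subspace_add[OF subspace_real_boundaries Int_retract[OF e] real_chain_map_boundary[OF \<beta>e \<alpha>]] by simp

text \<open>The inclusion of \<open>U \<inter> V\<close> into \<open>U\<close> inherits injectivity
  from \<open>f\<close>: the image of \<open>\<beta> e\<close> under \<open>f\<close> is the image
  under \<open>\<rho>\<close> of a cycle homologous in \<open>U\<close> to the boundary
  \<open>e\<close>, so \<open>\<beta> e\<close> bounds in \<open>Z\<close>.\<close>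

lemma Int_boundary_if_U_boundary:
  assumes e: "e \<in> real_cycles m (subtopology X (U \<inter> V))" "e \<in> real_boundaries m (subtopology X U)"
    and inj: "\<And>z. z \<in> real_cycles m Z \<Longrightarrow> real_chain_map m f z \<in> real_boundaries m L \<Longrightarrow> z \<in> real_boundaries m Z"
  shows "e \<in> real_boundaries m (subtopology X (U \<inter> V))"
proof (rule Int_boundary[OF e(1)])
  let ?z = "real_chain_map m \<beta> e"
  have z: "?z \<in> real_cycles m Z"
    by (rule real_chain_map_cycle[OF e(1) \<beta>])
  have "e - real_chain_map m \<alpha> ?z \<in> real_boundaries m (subtopology X U)"
    using Int_retract[OF e(1)] real_boundaries_mono[of "U \<inter> V" U m X] by blast
  then have "real_chain_map m \<alpha> ?z \<in> real_boundaries m (subtopology X U)"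
    using subspace_diff[OF subspace_real_boundaries e(2)] by fastforce
  then have "real_chain_map m \<rho> (real_chain_map m \<alpha> ?z) \<in> real_boundaries m L"
    by (rule real_chain_map_boundary[OF _ \<rho>])
  then have "real_chain_map m f ?z \<in> real_boundaries m L"
    using z by (simp add: \<rho>_\<alpha>_chain real_cycles_def)
  then show "?z \<in> real_boundaries m Z"
    by (rule inj[OF z])
qed

text \<open>The boundary \<open>w\<close> shared by the two halves of \<open>c\<close> represents
  the connecting class. It bounds in \<open>U\<close>, hence already in \<open>U \<inter> V\<close>,
  and trading the bounding chain \<open>g\<close> between the halves makes each of them a
  cycle.\<close>

lemma homologous_to_L:
  assumes c: "c \<in> real_cycles (Suc m) X"
    and inj: "\<And>z. z \<in> real_cycles m Z \<Longrightarrow> real_chain_map m f z \<in> real_boundaries m L \<Longrightarrow> z \<in> real_boundaries m Z"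
  obtains y where "y \<in> real_cycles (Suc m) L" "c - real_chain_map (Suc m) i y \<in> real_boundaries (Suc m) X"
proof -
  note bdry = linear_add[OF linear_real_boundary] linear_diff[OF linear_real_boundary]
  have c': "c \<in> real_chains (Suc m) X" "real_boundary (Suc m) c = 0"
    using c by (auto simp: real_cycles_def)
  obtain u v d where u: "u \<in> real_chains (Suc m) (subtopology X U)"
    and v: "v \<in> real_chains (Suc m) (subtopology X V)" and d: "d \<in> real_chains (Suc (Suc m)) X"
    and ceq: "c = u + v + real_boundary (Suc (Suc m)) d"
    by (rule small_real_chain[OF openU openV cover c'(1), of "{}"]) (auto simp: c'(2))
  define w where "w = real_boundary (Suc m) u"
  \<comment> \<open>As \<open>c\<close> is a cycle, the boundaries of its halves cancel;
    \<open>w\<close> lies in \<open>U\<close> by definition and in \<open>V\<close> by this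
    equation.\<close>
  have wv: "w = - real_boundary (Suc m) v"
    using c'(2) real_boundary_boundary[OF d]
    by (simp add: w_def ceq bdry eq_neg_iff_add_eq_0)
  have "w \<in> real_chains m (subtopology X U)"
    using real_boundary_in_chains[OF u] by (simp add: w_def)
  moreover have "w \<in> real_chains m (subtopology X V)"
    using subspace_neg[OF subspace_real_chains real_boundary_in_chains[OF v]] by (simp add: wv)
  ultimately have "w \<in> real_cycles m (subtopology X (U \<inter> V))"
    using real_chains_Int real_boundary_boundary[OF u] by (auto simp: real_cycles_def w_def)
  moreover have "w \<in> real_boundaries m (subtopology X U)"
    using u by (auto simp: w_def real_boundaries_def)
  ultimately have "w \<in> real_boundaries m (subtopology X (U \<inter> V))"
    using inj by (rule Int_boundary_if_U_boundary)
  then obtain g where g: "g \<in> real_chains (Suc m) (subtopology X (U \<inter> V))" "w = real_boundary (Suc m) g"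
    by (auto simp: real_boundaries_def)
  have gU: "g \<in> real_chains (Suc m) (subtopology X U)" and gV: "g \<in> real_chains (Suc m) (subtopology X V)"
    using g(1) real_chains_mono[of "U \<inter> V" U "Suc m" X] real_chains_mono[of "U \<inter> V" V "Suc m" X] by auto
  have ug: "u - g \<in> real_cycles (Suc m) (subtopology X U)"
    using g(2) subspace_diff[OF subspace_real_chains u gU] by (simp add: real_cycles_def bdry w_def)
  have "v + g \<in> real_cycles (Suc m) (subtopology X V)"
    using g(2) wv subspace_add[OF subspace_real_chains v gV] by (simp add: real_cycles_def bdry flip: g(2))
  \<comment> \<open>The half in \<open>V\<close> contributes nothing to the class, since
    \<open>V\<close> is contractible and the degree is positive.\<close>
  then have vg: "v + g \<in> real_boundaries (Suc m) X"
    using contractible_real_boundary[OF contr] real_boundaries_subtopology by blast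
  let ?y = "real_chain_map (Suc m) \<rho> (u - g)"
  have "u - g - real_chain_map (Suc m) i ?y \<in> real_boundaries (Suc m) X"
    using U_retract[OF ug] real_boundaries_subtopology by blast
  moreover have "real_boundary (Suc (Suc m)) d \<in> real_boundaries (Suc m) X"
    using d by (simp add: real_boundaries_def)
  ultimately have "(u - g - real_chain_map (Suc m) i ?y) + (v + g) + real_boundary (Suc (Suc m)) d \<in> real_boundaries (Suc m) X"
    using vg by (intro subspace_add[OF subspace_real_boundaries subspace_add[OF subspace_real_boundaries]])
  then have "c - real_chain_map (Suc m) i ?y \<in> real_boundaries (Suc m) X"
    by (simp add: ceq algebra_simps)
  then show thesis
    using that real_chain_map_cycle[OF ug \<rho>] by blast
qed

text \<open>Modulo a boundary, only the part \<open>v\<close> of the bounding chain leaves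
  \<open>U\<close>. The boundary of \<open>v\<close> is a cycle in \<open>U \<inter> V\<close>,
  where cycles of this degree bound because they do so in \<open>Z\<close>; hence the bounding can
  be redone inside \<open>U\<close>, and \<open>\<rho>\<close> carries it back to
  \<open>L\<close>.\<close>

lemma boundary_in_L:
  assumes y: "y \<in> real_cycles j L" and iy: "real_chain_map j i y \<in> real_boundaries j X"
    and Z0: "real_cycles j Z \<subseteq> real_boundaries j Z"
  shows "y \<in> real_boundaries j L"
proof -
  note bdry = linear_add[OF linear_real_boundary] linear_diff[OF linear_real_boundary]
  let ?a = "real_chain_map j i y"
  have a: "?a \<in> real_cycles j (subtopology X U)"
    by (rule real_chain_map_cycle[OF y i])
  obtain c where c: "c \<in> real_chains (Suc j) X" "?a = real_boundary (Suc j) c"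
    using iy by (auto simp: real_boundaries_def)
  \<comment> \<open>\<open>c\<close> need not be a cycle, but its boundary lies in \<open>U\<close>,
    so the splitting is taken relative to \<open>U\<close>.\<close>
  have "real_boundary (Suc j) c \<in> real_chains (Suc j - 1) (subtopology X U)"
    using a by (simp add: real_cycles_def flip: c(2))
  then obtain u v d e where u: "u \<in> real_chains (Suc j) (subtopology X U)"
    and v: "v \<in> real_chains (Suc j) (subtopology X V)" and d: "d \<in> real_chains (Suc (Suc j)) X"
    and e: "e \<in> real_chains (Suc j) (subtopology X U)" and ceq: "c = u + v + real_boundary (Suc (Suc j)) d + e"
    using small_real_chain[OF openU openV cover c(1)] by blast
  have ue: "u + e \<in> real_chains (Suc j) (subtopology X U)"
    using u e subspace_add[OF subspace_real_chains] by blast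
  define w where "w = real_boundary (Suc j) v"
  \<comment> \<open>As the boundary of \<open>v\<close>, the chain \<open>w\<close> lies in
    \<open>V\<close>; by this equation it also lies in \<open>U\<close>.\<close>
  have w: "w = ?a - real_boundary (Suc j) (u + e)"
    using c(2) real_boundary_boundary[OF d] by (simp add: ceq bdry w_def)
  have "w \<in> real_chains j (subtopology X U)"
    unfolding w using a real_boundary_in_chains[OF ue]
    by (intro subspace_diff[OF subspace_real_chains]) (auto simp: real_cycles_def)
  moreover have "w \<in> real_chains j (subtopology X V)"
    using real_boundary_in_chains[OF v] by (simp add: w_def)
  moreover have "real_boundary j w = 0"
    using real_boundary_boundary[OF v] by (simp add: w_def)
  ultimately have wc: "w \<in> real_cycles j (subtopology X (U \<inter> V))"
    using real_chains_Int by (auto simp: real_cycles_def)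
  have "w \<in> real_boundaries j (subtopology X (U \<inter> V))"
    using Int_boundary[OF wc] real_chain_map_cycle[OF wc \<beta>] Z0 by blast
  then have "w \<in> real_boundaries j (subtopology X U)"
    using real_boundaries_mono[of "U \<inter> V" U j X] by auto
  moreover have "real_boundary (Suc j) (u + e) \<in> real_boundaries j (subtopology X U)"
    using ue by (simp add: real_boundaries_def)
  ultimately have "w + real_boundary (Suc j) (u + e) \<in> real_boundaries j (subtopology X U)"
    by (rule subspace_add[OF subspace_real_boundaries])
  then have "real_chain_map j \<rho> ?a \<in> real_boundaries j L"
    using real_chain_map_boundary[OF _ \<rho>] by (simp add: w)
  moreover have "real_chain_map j \<rho> ?a = y"
    using y real_chain_map_id[of y j L "\<rho> \<circ> i"] by (simp add: \<rho>_i real_cycles_def real_chain_map_compose)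
  ultimately show ?thesis by simp
qed

text \<open>The cycle \<open>c\<close> is homologous to \<open>i y\<close> by
  \<open>homologous_to_L\<close>, then to \<open>i (f z)\<close> by surjectivity, then inside
  \<open>U\<close> to \<open>\<alpha> z\<close>, which bounds in \<open>V\<close>.\<close>

lemma cycle_is_boundary:
  assumes c: "c \<in> real_cycles (Suc m) X"
    and inj: "\<And>z. z \<in> real_cycles m Z \<Longrightarrow> real_chain_map m f z \<in> real_boundaries m L \<Longrightarrow> z \<in> real_boundaries m Z"
    and surj: "\<And>y. y \<in> real_cycles (Suc m) L \<Longrightarrow>
      \<exists>z\<in>real_cycles (Suc m) Z. y - real_chain_map (Suc m) f z \<in> real_boundaries (Suc m) L"
  shows "c \<in> real_boundaries (Suc m) X"
proof -
  obtain y where y: "y \<in> real_cycles (Suc m) L" "c - real_chain_map (Suc m) i y \<in> real_boundaries (Suc m) X"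
    using homologous_to_L[OF c inj] by blast
  obtain z where z: "z \<in> real_cycles (Suc m) Z" "y - real_chain_map (Suc m) f z \<in> real_boundaries (Suc m) L"
    using surj[OF y(1)] by blast
  have "real_chain_map (Suc m) i (y - real_chain_map (Suc m) f z) \<in> real_boundaries (Suc m) X"
    using real_chain_map_boundary[OF z(2) i] real_boundaries_subtopology by blast
  then have yz: "real_chain_map (Suc m) i y - real_chain_map (Suc m) i (real_chain_map (Suc m) f z) \<in> real_boundaries (Suc m) X"
    by (simp add: linear_diff[OF linear_real_chain_map])
  let ?b = "real_chain_map (Suc m) \<alpha> z"
  have b: "?b \<in> real_cycles (Suc m) (subtopology X (U \<inter> V))"
    by (rule real_chain_map_cycle[OF z(1) \<alpha>])
  then have "?b \<in> real_cycles (Suc m) (subtopology X V)" and bU: "?b \<in> real_cycles (Suc m) (subtopology X U)"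
    using real_cycles_mono[of "U \<inter> V" V "Suc m" X] real_cycles_mono[of "U \<inter> V" U "Suc m" X] by auto
  then have bV: "?b \<in> real_boundaries (Suc m) X"
    using contractible_real_boundary[OF contr] real_boundaries_subtopology by blast
  have "?b - real_chain_map (Suc m) i (real_chain_map (Suc m) f z) \<in> real_boundaries (Suc m) X"
    using U_retract[OF bU] real_boundaries_subtopology z(1) by (auto simp: \<rho>_\<alpha>_chain real_cycles_def)
  then have "?b - (?b - real_chain_map (Suc m) i (real_chain_map (Suc m) f z)) \<in> real_boundaries (Suc m) X"
    by (rule subspace_diff[OF subspace_real_boundaries bV])
  \<comment> \<open>These homologies telescope to \<open>c\<close>; the last bracket is
    \<open>i (f z)\<close>, written as a difference of two boundaries.\<close>
  then have "(c - real_chain_map (Suc m) i y)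
     + (real_chain_map (Suc m) i y - real_chain_map (Suc m) i (real_chain_map (Suc m) f z))
     + (?b - (?b - real_chain_map (Suc m) i (real_chain_map (Suc m) f z))) \<in> real_boundaries (Suc m) X"
    by (intro subspace_add[OF subspace_real_boundaries] y yz)
  then show ?thesis by simp
qed

end

section \<open>Maps out of disjoint sums and quotients\<close>

lemma mem_Plus_iff [simp]: "Inl x \<in> A <+> B \<longleftrightarrow> x \<in> A" "Inr y \<in> A <+> B \<longleftrightarrow> y \<in> B"
  by auto

lemma vimage_Plus [simp]: "Inl -` (A <+> B) = A" "Inr -` (A <+> B) = B"
  by auto

lemma image_map_sum_Plus: "map_sum a b ` (A <+> B) = a ` A <+> b ` B"
  by (simp add: Plus_def image_Un image_image)

lemma subtopology_disjoint_sum: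
  "subtopology (disjoint_sum A B) S = disjoint_sum (subtopology A (Inl -` S)) (subtopology B (Inr -` S))"
  unfolding topology_eq
proof (intro allI iffI)
  fix U assume "openin (subtopology (disjoint_sum A B) S) U"
  then obtain T where "openin A (Inl -` T)" "openin B (Inr -` T)" "U = T \<inter> S"
    by (auto simp: openin_subtopology openin_disjoint_sum)
  then show "openin (disjoint_sum (subtopology A (Inl -` S)) (subtopology B (Inr -` S))) U"
    unfolding openin_disjoint_sum openin_subtopology vimage_Int by blast
next
  fix U assume "openin (disjoint_sum (subtopology A (Inl -` S)) (subtopology B (Inr -` S))) U"
  then obtain T1 T2 where T: "openin A T1" "Inl -` U = T1 \<inter> Inl -` S" "openin B T2" "Inr -` U = T2 \<inter> Inr -` S"
    unfolding openin_disjoint_sum openin_subtopology by auto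
  have "openin (disjoint_sum A B) (T1 <+> T2)"
    by (simp add: openin_disjoint_sum T)
  moreover have "x \<in> U \<longleftrightarrow> x \<in> (T1 <+> T2) \<inter> S" for x
    using T(2,4) by (cases x) (auto simp: set_eq_iff)
  ultimately show "openin (subtopology (disjoint_sum A B) S) U"
    unfolding openin_subtopology by blast
qed

lemma continuous_map_Inl: "continuous_map (A :: 'a topology) (disjoint_sum A (B :: 'c topology)) Inl"
proof -
  have "{x \<in> topspace A. Inl x \<in> U} = Inl -` U" if "openin A (Inl -` U)" for U :: "('a + 'c) set"
    using openin_subset[OF that] by auto
  then show ?thesis
    by (auto simp: continuous_map_def openin_disjoint_sum topspace_disjoint_sum)
qed

lemma continuous_map_Inr: "continuous_map (B :: 'b topology) (disjoint_sum (A :: 'a topology) B) Inr"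
proof -
  have "{x \<in> topspace B. Inr x \<in> U} = Inr -` U" if "openin B (Inr -` U)" for U :: "('a + 'b) set"
    using openin_subset[OF that] by auto
  then show ?thesis
    by (auto simp: continuous_map_def openin_disjoint_sum topspace_disjoint_sum)
qed

text \<open>Products distribute over disjoint sums, so a homotopy on the space before gluing can be
  given by separate formulas on cylinder and cone.\<close>

lemma continuous_map_prod_disjoint_sum:
  assumes A: "continuous_map (prod_topology T A) W (\<lambda>(t, a). g (t, Inl a))"
    and B: "continuous_map (prod_topology T B) W (\<lambda>(t, b). g (t, Inr b))"
  shows "continuous_map (prod_topology T (disjoint_sum A B)) W g"
  unfolding continuous_map_def
proof (intro conjI allI impI)
  show "g \<in> topspace (prod_topology T (disjoint_sum A B)) \<rightarrow> topspace W"
    using continuous_map_image_subset_topspace[OF A] continuous_map_image_subset_topspace[OF B]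
    by (auto simp: topspace_disjoint_sum image_subset_iff)
  fix O' assume O': "openin W O'"
  let ?S = "{p \<in> topspace (prod_topology T (disjoint_sum A B)). g p \<in> O'}"
  show "openin (prod_topology T (disjoint_sum A B)) ?S"
    unfolding openin_prod_topology_alt
  proof (intro allI impI)
    fix t y assume ty: "(t, y) \<in> ?S"
    show "\<exists>U V. openin T U \<and> openin (disjoint_sum A B) V \<and> t \<in> U \<and> y \<in> V \<and> U \<times> V \<subseteq> ?S"
    proof (cases y)
      case (Inl a)
      have "openin (prod_topology T A) {p \<in> topspace (prod_topology T A). (case p of (t, a) \<Rightarrow> g (t, Inl a)) \<in> O'}"
        using A O' openin_continuous_map_preimage by blast
      moreover have "(t, a) \<in> {p \<in> topspace (prod_topology T A). (case p of (t, a) \<Rightarrow> g (t, Inl a)) \<in> O'}"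
        using ty Inl by (auto simp: topspace_disjoint_sum)
      ultimately obtain U V where UV: "openin T U" "openin A V" "t \<in> U" "a \<in> V"
        "U \<times> V \<subseteq> {p \<in> topspace (prod_topology T A). (case p of (t, a) \<Rightarrow> g (t, Inl a)) \<in> O'}"
        unfolding openin_prod_topology_alt by meson
      have "openin (disjoint_sum A B) (V <+> {})"
        using UV by (simp add: openin_disjoint_sum)
      then show ?thesis
        using UV Inl by (intro exI[of _ U] exI[of _ "V <+> {}"]) (auto simp: topspace_disjoint_sum)
    next
      case (Inr b)
      have "openin (prod_topology T B) {p \<in> topspace (prod_topology T B). (case p of (t, b) \<Rightarrow> g (t, Inr b)) \<in> O'}"
        using B O' openin_continuous_map_preimage by blast
      moreover have "(t, b) \<in> {p \<in> topspace (prod_topology T B). (case p of (t, b) \<Rightarrow> g (t, Inr b)) \<in> O'}"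
        using ty Inr by (auto simp: topspace_disjoint_sum)
      ultimately obtain U V where UV: "openin T U" "openin B V" "t \<in> U" "b \<in> V"
        "U \<times> V \<subseteq> {p \<in> topspace (prod_topology T B). (case p of (t, b) \<Rightarrow> g (t, Inr b)) \<in> O'}"
        unfolding openin_prod_topology_alt by meson
      have "openin (disjoint_sum A B) ({} <+> V)"
        using UV by (simp add: openin_disjoint_sum)
      then show ?thesis
        using UV Inr by (intro exI[of _ U] exI[of _ "{} <+> V"]) (auto simp: topspace_disjoint_sum)
    qed
  qed
qed

lemma continuous_map_disjoint_sum:
  assumes A: "continuous_map A W (g \<circ> Inl)" and B: "continuous_map B W (g \<circ> Inr)"
  shows "continuous_map (disjoint_sum A B) W g"
  unfolding continuous_map_def
proof (intro conjI allI impI)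
  show "g \<in> topspace (disjoint_sum A B) \<rightarrow> topspace W"
    using continuous_map_image_subset_topspace[OF A] continuous_map_image_subset_topspace[OF B]
    by (auto simp: topspace_disjoint_sum image_subset_iff)
  fix O' assume O': "openin W O'"
  have "Inl -` {x \<in> topspace (disjoint_sum A B). g x \<in> O'} = {x \<in> topspace A. (g \<circ> Inl) x \<in> O'}"
    and "Inr -` {x \<in> topspace (disjoint_sum A B). g x \<in> O'} = {x \<in> topspace B. (g \<circ> Inr) x \<in> O'}"
    by (auto simp: topspace_disjoint_sum)
  then show "openin (disjoint_sum A B) {x \<in> topspace (disjoint_sum A B). g x \<in> O'}"
    using A B O' unfolding openin_disjoint_sum by (simp add: openin_continuous_map_preimage del: o_apply)
qed

text \<open>The cone is already a quotient when it is glued; this lets both identifications be made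
  by one quotient map out of a plain disjoint sum.\<close>

lemma quotient_map_map_sum:
  assumes a: "quotient_map A A' a" and b: "quotient_map B B' b"
  shows "quotient_map (disjoint_sum A B) (disjoint_sum A' B') (map_sum a b)"
  unfolding quotient_map_def
proof (intro conjI allI impI)
  show "map_sum a b ` topspace (disjoint_sum A B) = topspace (disjoint_sum A' B')"
    by (simp add: topspace_disjoint_sum image_map_sum_Plus quotient_imp_surjective_map[OF a]
        quotient_imp_surjective_map[OF b])
  fix U assume "U \<subseteq> topspace (disjoint_sum A' B')"
  then have "Inl -` U \<subseteq> topspace A'" "Inr -` U \<subseteq> topspace B'"
    by (auto simp: topspace_disjoint_sum)
  then have "openin A {x \<in> topspace A. a x \<in> Inl -` U} = openin A' (Inl -` U)"
    "openin B {x \<in> topspace B. b x \<in> Inr -` U} = openin B' (Inr -` U)"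
    using a b unfolding quotient_map_def by blast+
  moreover have "Inl -` {x \<in> topspace (disjoint_sum A B). map_sum a b x \<in> U} = {x \<in> topspace A. a x \<in> Inl -` U}"
    "Inr -` {x \<in> topspace (disjoint_sum A B). map_sum a b x \<in> U} = {x \<in> topspace B. b x \<in> Inr -` U}"
    by (auto simp: topspace_disjoint_sum)
  ultimately show "openin (disjoint_sum A B) {x \<in> topspace (disjoint_sum A B). map_sum a b x \<in> U} =
        openin (disjoint_sum A' B') U"
    by (simp only: openin_disjoint_sum)
qed

section \<open>Classes of a generated equivalence relation\<close>

text \<open>Having equal values under \<open>G\<close> is itself an equivalence relation, so it is
  enough that the generators respect it.\<close>

lemma gluing_rel_respects:
  assumes "(x, y) \<in> gluing_rel X r"
    and "\<And>a b. (a, b) \<in> r \<Longrightarrow> a \<in> topspace X \<Longrightarrow> b \<in> topspace X \<Longrightarrow> G a = G b"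
  shows "G x = G y"
proof -
  let ?s = "r \<inter> topspace X \<times> topspace X"
  have "(x, y) \<in> (?s \<union> ?s\<inverse>)\<^sup>*"
    using assms(1) by (simp add: gluing_rel_def Let_def)
  then show ?thesis
    by (induction rule: rtrancl_induct) (use assms(2) in auto)
qed

lemma gluing_class_eq:
  assumes "(a, b) \<in> r" "a \<in> topspace X" "b \<in> topspace X"
  shows "gluing_rel X r `` {a} = gluing_rel X r `` {b}"
proof (rule equiv_class_eq[OF equiv_gluing_rel])
  show "(a, b) \<in> gluing_rel X r"
    using assms by (auto simp: gluing_rel_def Let_def)
qed

lemma gluing_class_eqD:
  assumes "gluing_rel X r `` {x} = gluing_rel X r `` {y}" "y \<in> topspace X"
    and "\<And>a b. (a, b) \<in> r \<Longrightarrow> a \<in> topspace X \<Longrightarrow> b \<in> topspace X \<Longrightarrow> G a = G b"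
  shows "G x = G y"
  using gluing_rel_respects[OF eq_equiv_class[OF assms(1) equiv_gluing_rel assms(2)] assms(3)] .

section \<open>The space obtained by gluing a cone to a cylinder\<close>

text \<open>The space before any identification, on which maps and homotopies have coordinate
  formulas.\<close>

abbreviation glue_dom :: "'a topology \<Rightarrow> 'b topology \<Rightarrow> (('a \<times> real) + ('b \<times> real)) topology" where
  "glue_dom L Z \<equiv> disjoint_sum (prod_topology L (top_of_set {0..<1})) (prod_topology Z (top_of_set {0..1}))"

definition cone_class :: "'b topology \<Rightarrow> 'b \<times> real \<Rightarrow> ('b \<times> real) set" where
  "cone_class Z w = gluing_rel (prod_topology Z (top_of_set {0..1})) cone_rel `` {w}"

definition glue_proj :: "'a topology \<Rightarrow> 'b topology \<Rightarrow> ('b \<Rightarrow> 'a) \<Rightarrow> ('a \<times> real) + ('b \<times> real) \<Rightarrow>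
    (('a \<times> real) + ('b \<times> real) set) set" where
  "glue_proj L Z f d =
     gluing_rel (disjoint_sum (prod_topology L (top_of_set {0..<1})) (closed_cone Z))
       {(Inl (f x, 0), Inr (cone_base Z x)) | x. x \<in> topspace Z} `` {map_sum id (cone_class Z) d}"

lemma quotient_map_cone_class: "quotient_map (prod_topology Z (top_of_set {0..1})) (closed_cone Z) (cone_class Z)"
  unfolding closed_cone_def cone_class_def[abs_def] by (rule quotient_map_quotient_space)

lemma quotient_map_glue_proj: "quotient_map (glue_dom L Z) (glue_cone L Z f) (glue_proj L Z f)"
proof -
  have "quotient_map (glue_dom L Z) (glue_cone L Z f)
     ((\<lambda>x. gluing_rel (disjoint_sum (prod_topology L (top_of_set {0..<1})) (closed_cone Z))
       {(Inl (f x, 0), Inr (cone_base Z x)) | x. x \<in> topspace Z} `` {x}) \<circ> map_sum id (cone_class Z))"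
    unfolding glue_cone_def
    by (rule quotient_map_compose[OF quotient_map_map_sum[OF _ quotient_map_cone_class] quotient_map_quotient_space])
      (simp add: quotient_map_def Collect_conj_eq Int_absorb1 openin_subset)
  then show ?thesis
    by (simp add: o_def glue_proj_def[abs_def])
qed

lemma glue_proj_apex:
  "z \<in> topspace Z \<Longrightarrow> z' \<in> topspace Z \<Longrightarrow> glue_proj L Z f (Inr (z, 1)) = glue_proj L Z f (Inr (z', 1))"
  using gluing_class_eq[of "(z, 1)" "(z', 1)" cone_rel "prod_topology Z (top_of_set {0..1})"]
  by (simp add: glue_proj_def cone_class_def) (simp add: cone_rel_def)

lemma glue_proj_base:
  assumes "z \<in> topspace Z" "f z \<in> topspace L"
  shows "glue_proj L Z f (Inl (f z, 0)) = glue_proj L Z f (Inr (z, 0))"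
  unfolding glue_proj_def
proof (rule gluing_class_eq)
  have "cone_class Z (z, 0) = cone_base Z z"
    by (simp add: cone_class_def cone_base_def)
  then show "(map_sum id (cone_class Z) (Inl (f z, 0)), map_sum id (cone_class Z) (Inr (z, 0)))
      \<in> {(Inl (f x, 0), Inr (cone_base Z x)) |x. x \<in> topspace Z}"
    using assms by auto
  have "cone_class Z (z, 0) \<in> topspace (closed_cone Z)"
    using quotient_imp_surjective_map[OF quotient_map_cone_class[of Z]] assms by auto
  then show "map_sum id (cone_class Z) (Inl (f z, 0 :: real)) \<in> topspace (disjoint_sum (prod_topology L (top_of_set {0..<1::real})) (closed_cone Z))"
    "map_sum id (cone_class Z) (Inr (z, 0)) \<in> topspace (disjoint_sum (prod_topology L (top_of_set {0..<1::real})) (closed_cone Z))"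
    using assms by (auto simp: topspace_disjoint_sum)
qed

text \<open>Covers the two kinds of identification, the collapse at the apex and the attachment
  along \<open>f\<close>; by \<open>glue_proj_eq_imp\<close> nothing else has to be checked for
  \<open>G\<close> to descend.\<close>

definition glue_compatible :: "'b topology \<Rightarrow> ('b \<Rightarrow> 'a) \<Rightarrow> (('a \<times> real) + ('b \<times> real) \<Rightarrow> 'c) \<Rightarrow> bool" where
  "glue_compatible Z f G \<longleftrightarrow>
     (\<forall>z\<in>topspace Z. \<forall>z'\<in>topspace Z. G (Inr (z, 1)) = G (Inr (z', 1))) \<and>
     (\<forall>z\<in>topspace Z. G (Inl (f z, 0)) = G (Inr (z, 0)))"

text \<open>Follows the two stages of the quotient: \<open>G\<close> first descends to
  \<open>G'\<close> on the closed cone, and \<open>G'\<close> then respects the attachment.\<close>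

lemma glue_proj_eq_imp:
  assumes G: "glue_compatible Z f G" and d: "d \<in> topspace (glue_dom L Z)" "d' \<in> topspace (glue_dom L Z)"
    and eq: "glue_proj L Z f d = glue_proj L Z f d'"
  shows "G d = G d'"
proof -
  let ?C = "prod_topology Z (top_of_set {0..1::real})"
  have Gcone: "G (Inr w) = G (Inr w')"
    if "cone_class Z w = cone_class Z w'" "w' \<in> topspace ?C" for w w'
    using that(1)[unfolded cone_class_def] that(2)
  proof (rule gluing_class_eqD)
    fix a b assume ab: "(a, b) \<in> cone_rel" "a \<in> topspace ?C" "b \<in> topspace ?C"
    obtain z z' where eqs: "a = (z, 1)" "b = (z', 1)"
      using ab(1) by (auto simp: cone_rel_def)
    have "z \<in> topspace Z" "z' \<in> topspace Z"
      using ab(2,3) by (simp_all add: eqs)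
    then show "G (Inr a) = G (Inr b)"
      unfolding eqs using G[unfolded glue_compatible_def] by blast
  qed
  \<comment> \<open>A class in the cone has no canonical representative; by \<open>Gcone\<close> any
    choice gives the same value.\<close>
  define G' where "G' = case_sum (\<lambda>y. G (Inl y)) (\<lambda>C. G (Inr (SOME w. w \<in> topspace ?C \<and> cone_class Z w = C)))"
  have G'Inr: "G' (Inr (cone_class Z w)) = G (Inr w)" if "w \<in> topspace ?C" for w
  proof -
    let ?w = "SOME w'. w' \<in> topspace ?C \<and> cone_class Z w' = cone_class Z w"
    have "?w \<in> topspace ?C \<and> cone_class Z ?w = cone_class Z w"
      using that by (intro someI[of "\<lambda>w'. w' \<in> topspace ?C \<and> cone_class Z w' = cone_class Z w" w]) simp
    then have "G (Inr ?w) = G (Inr w)"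
      by (intro Gcone that) (rule conjunct2)
    then show ?thesis
      unfolding G'_def sum.case .
  qed
  have G'G: "G' (map_sum id (cone_class Z) e) = G e" if "e \<in> topspace (glue_dom L Z)" for e
    using that G'Inr by (cases e) (auto simp: G'_def topspace_disjoint_sum)
  have "G' (map_sum id (cone_class Z) d) = G' (map_sum id (cone_class Z) d')"
    using eq[unfolded glue_proj_def]
  proof (rule gluing_class_eqD)
    have "map_sum id (cone_class Z) ` topspace (glue_dom L Z) \<subseteq>
        topspace (disjoint_sum (prod_topology L (top_of_set {0..<1})) (closed_cone Z))"
      by (simp add: topspace_disjoint_sum image_map_sum_Plus
          flip: quotient_imp_surjective_map[OF quotient_map_cone_class[of Z]])
    then show "map_sum id (cone_class Z) d' \<in> topspace (disjoint_sum (prod_topology L (top_of_set {0..<1})) (closed_cone Z))"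
      using d by blast
    show "G' a = G' b" if ab: "(a, b) \<in> {(Inl (f x, 0), Inr (cone_base Z x)) |x. x \<in> topspace Z}" for a b
    proof -
      obtain x where x: "x \<in> topspace Z" "a = Inl (f x, 0)" "b = Inr (cone_class Z (x, 0))"
        using ab by (auto simp: cone_base_def cone_class_def)
      have "G' a = G (Inl (f x, 0))"
        by (simp add: x G'_def)
      also have "\<dots> = G (Inr (x, 0))"
        using G x(1) by (simp add: glue_compatible_def)
      also have "\<dots> = G' b"
        using G'Inr[of "(x, 0)"] x(1) by (simp add: x(3))
      finally show ?thesis .
    qed
  qed
  then show ?thesis
    using G'G d by simp
qed

text \<open>A quotient map restricted to the preimage of an open set is again a quotient map. The
  local form serves \<open>\<rho>\<close> and \<open>\<beta>\<close>, which are constructed on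
  \<open>U\<close> and on \<open>U \<inter> V\<close> only.\<close>

lemma glue_lift_on:
  assumes G: "glue_compatible Z f G" and T: "openin (glue_cone L Z f) T"
    and cont: "continuous_map (subtopology (glue_dom L Z) {d \<in> topspace (glue_dom L Z). glue_proj L Z f d \<in> T}) Y G"
  obtains g where "continuous_map (subtopology (glue_cone L Z f) T) Y g"
    "\<And>d. d \<in> topspace (glue_dom L Z) \<Longrightarrow> glue_proj L Z f d \<in> T \<Longrightarrow> g (glue_proj L Z f d) = G d"
proof -
  let ?S = "{d \<in> topspace (glue_dom L Z). glue_proj L Z f d \<in> T}"
  have q: "quotient_map (subtopology (glue_dom L Z) ?S) (subtopology (glue_cone L Z f) T) (glue_proj L Z f)"
    by (rule quotient_map_restriction[OF quotient_map_glue_proj refl]) (simp add: T)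
  have top: "topspace (subtopology (glue_dom L Z) ?S) = ?S"
    by (auto simp: topspace_subtopology)
  obtain g where g: "continuous_map (subtopology (glue_cone L Z f) T) Y g"
    and "\<And>d. d \<in> topspace (subtopology (glue_dom L Z) ?S) \<Longrightarrow> g (glue_proj L Z f d) = G d"
  proof (rule quotient_map_lift_exists[OF q cont])
    show "G d = G d'" if "d \<in> topspace (subtopology (glue_dom L Z) ?S)" "d' \<in> topspace (subtopology (glue_dom L Z) ?S)"
      "glue_proj L Z f d = glue_proj L Z f d'" for d d'
      using that unfolding top by (intro glue_proj_eq_imp[OF G]) simp_all
  qed (rule that)
  then have "\<And>d. d \<in> topspace (glue_dom L Z) \<Longrightarrow> glue_proj L Z f d \<in> T \<Longrightarrow> g (glue_proj L Z f d) = G d"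
    unfolding top by blast
  then show thesis
    using that[OF g] by blast
qed

lemma convex_combination_mem:
  fixes x y t :: real
  assumes "convex S" "x \<in> S" "y \<in> S" "0 \<le> t" "t \<le> 1"
  shows "(1 - t) * x + t * y \<in> S"
  using convexD[OF assms(1-3), of "1 - t" t] assms(4,5) by simp

text \<open>Lets one deformation of the whole space serve any subset that it keeps inside itself at
  all times.\<close>

lemma homotopic_with_subtopology:
  assumes H: "continuous_map (prod_topology (top_of_set {0..1::real}) X) X H"
    and H0: "\<And>x. x \<in> topspace X \<Longrightarrow> x \<in> T \<Longrightarrow> H (0, x) = x"
    and HT: "\<And>x t. x \<in> topspace X \<Longrightarrow> x \<in> T \<Longrightarrow> 0 \<le> t \<Longrightarrow> t \<le> 1 \<Longrightarrow> H (t, x) \<in> T"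
    and H1: "\<And>x. x \<in> topspace X \<Longrightarrow> x \<in> T \<Longrightarrow> H (1, x) = g x"
  shows "homotopic_with (\<lambda>_. True) (subtopology X T) (subtopology X T) id g"
proof -
  have "continuous_map (prod_topology (top_of_set {0..1::real}) (subtopology X T)) X H"
    using continuous_map_from_subtopology[OF H, of "{0..1} \<times> T"]
    by (simp add: prod_topology_subtopology(2))
  then have "continuous_map (prod_topology (top_of_set {0..1::real}) (subtopology X T)) (subtopology X T) H"
    using HT by (auto simp: continuous_map_in_subtopology)
  then show ?thesis
    using H0 H1 by (subst homotopic_with) auto
qed

section \<open>Height function, deformations and cover of the glued space\<close>

locale cone_gluing =
  fixes L :: "'a topology" and Z :: "'b topology" and f :: "'b \<Rightarrow> 'a"
  assumes f: "continuous_map Z L f"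
begin

abbreviation "D \<equiv> glue_dom L Z"
abbreviation "X \<equiv> glue_cone L Z f"
abbreviation "Q \<equiv> glue_proj L Z f"

lemma f_in: "z \<in> topspace Z \<Longrightarrow> f z \<in> topspace L"
  using f by (auto simp: continuous_map_def)

lemma continuous_map_Q: "continuous_map D X Q"
  by (rule quotient_imp_continuous_map[OF quotient_map_glue_proj])

lemma Q_Inl_in: "x \<in> topspace L \<Longrightarrow> 0 \<le> r \<Longrightarrow> r < 1 \<Longrightarrow> Q (Inl (x, r)) \<in> topspace X"
  and Q_Inr_in: "z \<in> topspace Z \<Longrightarrow> 0 \<le> s \<Longrightarrow> s \<le> 1 \<Longrightarrow> Q (Inr (z, s)) \<in> topspace X"
  using continuous_map_Q by (auto simp: continuous_map_def topspace_disjoint_sum Pi_iff)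

lemma X_cases:
  assumes "p \<in> topspace X"
  obtains (cylinder) x r where "x \<in> topspace L" "0 \<le> r" "r < 1" "p = Q (Inl (x, r))"
  | (cone) z s where "z \<in> topspace Z" "0 \<le> s" "s \<le> 1" "p = Q (Inr (z, s))"
proof -
  obtain d where "d \<in> topspace D" "p = Q d"
    using assms quotient_imp_surjective_map[OF quotient_map_glue_proj[of L Z f]] by blast
  then show thesis
    using that by (auto simp: topspace_disjoint_sum)
qed

lemma continuous_map_Q_Inl: "continuous_map (prod_topology L (top_of_set {0..<1})) X (\<lambda>y. Q (Inl y))"
  using continuous_map_compose[OF continuous_map_Inl continuous_map_Q] by (simp add: o_def)

lemma continuous_map_Q_Inr: "continuous_map (prod_topology Z (top_of_set {0..1})) X (\<lambda>w. Q (Inr w))"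
  using continuous_map_compose[OF continuous_map_Inr continuous_map_Q] by (simp add: o_def)

lemma continuous_map_real_snd: "continuous_map (prod_topology A (top_of_set S)) euclideanreal snd"
  by (rule continuous_map_into_fulltopology[OF continuous_map_snd])

text \<open>The opposite signs place cylinder and cone on the two sides of height 0, where they are
  attached; open conditions on \<open>h\<close> then cut out open sets of the quotient.\<close>

lemma height_exists:
  obtains h :: "_ \<Rightarrow> real" where "continuous_map X euclideanreal h"
    "\<And>x r. x \<in> topspace L \<Longrightarrow> 0 \<le> r \<Longrightarrow> r < 1 \<Longrightarrow> h (Q (Inl (x, r))) = - r"
    "\<And>z s. z \<in> topspace Z \<Longrightarrow> 0 \<le> s \<Longrightarrow> s \<le> 1 \<Longrightarrow> h (Q (Inr (z, s))) = s"
proof -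
  let ?G = "case_sum (\<lambda>y. - snd y) snd :: ('a \<times> real) + ('b \<times> real) \<Rightarrow> real"
  have G: "glue_compatible Z f ?G"
    by (simp add: glue_compatible_def)
  have "continuous_map D euclideanreal ?G"
    by (rule continuous_map_disjoint_sum)
      (simp_all add: o_def continuous_map_real_snd continuous_map_minus)
  then have "continuous_map (subtopology D {d \<in> topspace D. Q d \<in> topspace X}) euclideanreal ?G"
    by (rule continuous_map_from_subtopology)
  then obtain h where h: "continuous_map (subtopology X (topspace X)) euclideanreal h"
    and hG: "\<And>d. d \<in> topspace D \<Longrightarrow> Q d \<in> topspace X \<Longrightarrow> h (Q d) = ?G d"
    using glue_lift_on[OF G openin_topspace] by blast
  show thesis
  proof (rule that)
    show "continuous_map X euclideanreal h" using h by simp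
    show "h (Q (Inl (x, r))) = - r" if "x \<in> topspace L" "0 \<le> r" "r < 1" for x r
      using hG[of "Inl (x, r)"] Q_Inl_in[OF that] that by (simp add: topspace_disjoint_sum)
    show "h (Q (Inr (z, s))) = s" if "z \<in> topspace Z" "0 \<le> s" "s \<le> 1" for z s
      using hG[of "Inr (z, s)"] Q_Inr_in[OF that] that by (simp add: topspace_disjoint_sum)
  qed
qed

text \<open>Heights move linearly in time, to the base on the cylinder and along the profile
  \<open>\<psi>\<close> on the cone. The value of \<open>\<psi>\<close> at 0 makes the two formulas
  agree where they are attached, and the value at 1 keeps the apex in place.\<close>

lemma deformation_exists:
  assumes \<psi>: "continuous_on {0..1} \<psi>" "\<And>s. 0 \<le> s \<Longrightarrow> s \<le> 1 \<Longrightarrow> 0 \<le> \<psi> s \<and> \<psi> s \<le> 1"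
    and ends: "\<psi> 0 = (0::real)" "\<psi> 1 = 1"
  obtains H where "continuous_map (prod_topology (top_of_set {0..1::real}) X) X H"
    "\<And>t x r. 0 \<le> t \<Longrightarrow> t \<le> 1 \<Longrightarrow> x \<in> topspace L \<Longrightarrow> 0 \<le> r \<Longrightarrow> r < 1 \<Longrightarrow>
       H (t, Q (Inl (x, r))) = Q (Inl (x, (1 - t) * r))"
    "\<And>t z s. 0 \<le> t \<Longrightarrow> t \<le> 1 \<Longrightarrow> z \<in> topspace Z \<Longrightarrow> 0 \<le> s \<Longrightarrow> s \<le> 1 \<Longrightarrow>
       H (t, Q (Inr (z, s))) = Q (Inr (z, (1 - t) * s + t * \<psi> s))"
proof -
  let ?I = "top_of_set {0..1::real}"
  define G where "G = (\<lambda>(t, d). case d of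
      Inl y \<Rightarrow> Q (Inl (fst y, (1 - t) * snd y))
    | Inr w \<Rightarrow> Q (Inr (fst w, (1 - t) * snd w + t * \<psi> (snd w))))"
  have t_cont: "continuous_map (prod_topology ?I (prod_topology A (top_of_set S))) euclideanreal fst"
    and pt_cont: "continuous_map (prod_topology ?I (prod_topology A (top_of_set S))) A (\<lambda>p. fst (snd p))"
    and s_cont': "continuous_map (prod_topology ?I (prod_topology A (top_of_set S))) (top_of_set S) (\<lambda>p. snd (snd p))"
    for A :: "'c topology" and S :: "real set"
    by (auto intro: continuous_map_into_fulltopology[OF continuous_map_fst]
        continuous_map_compose[OF continuous_map_snd continuous_map_fst, unfolded o_def]
        continuous_map_compose[OF continuous_map_snd continuous_map_snd, unfolded o_def])
  then have s_cont: "continuous_map (prod_topology ?I (prod_topology A (top_of_set S))) euclideanreal (\<lambda>p. snd (snd p))"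
    for A :: "'c topology" and S :: "real set"
    using continuous_map_into_fulltopology by blast
  have G: "continuous_map (prod_topology ?I D) X G"
  proof (rule continuous_map_prod_disjoint_sum)
    have "continuous_map (prod_topology ?I (prod_topology L (top_of_set {0..<1}))) (prod_topology L (top_of_set {0..<1}))
        (\<lambda>p. (fst (snd p), (1 - fst p) * snd (snd p)))"
    proof (intro continuous_map_pairedI continuous_map_into_subtopology)
      show "(\<lambda>p. (1 - fst p) * snd (snd p)) \<in>
          topspace (prod_topology ?I (prod_topology L (top_of_set {0..<1}))) \<rightarrow> {0..<1::real}"
        using convex_combination_mem[of "{0..<1}" _ 0] by force
    qed (intro continuous_intros t_cont pt_cont s_cont)+
    from continuous_map_compose[OF this continuous_map_Q_Inl]
    show "continuous_map (prod_topology ?I (prod_topology L (top_of_set {0..<1}))) X (\<lambda>(t, a). G (t, Inl a))"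
      by (simp add: o_def G_def case_prod_unfold)
    have "continuous_map ?I euclideanreal \<psi>"
      using \<psi>(1) by simp
    from continuous_map_compose[OF s_cont' this]
    have \<psi>_cont: "continuous_map (prod_topology ?I (prod_topology Z ?I)) euclideanreal (\<lambda>p. \<psi> (snd (snd p)))"
      by (simp add: o_def)
    have "continuous_map (prod_topology ?I (prod_topology Z ?I)) (prod_topology Z ?I)
        (\<lambda>p. (fst (snd p), (1 - fst p) * snd (snd p) + fst p * \<psi> (snd (snd p))))"
    proof (intro continuous_map_pairedI continuous_map_into_subtopology)
      show "(\<lambda>p. (1 - fst p) * snd (snd p) + fst p * \<psi> (snd (snd p))) \<in>
          topspace (prod_topology ?I (prod_topology Z ?I)) \<rightarrow> {0..1::real}"
        using convex_combination_mem[of "{0..1}"] \<psi>(2) by force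
    qed (intro continuous_intros t_cont pt_cont s_cont \<psi>_cont)+
    from continuous_map_compose[OF this continuous_map_Q_Inr]
    show "continuous_map (prod_topology ?I (prod_topology Z ?I)) X (\<lambda>(t, b). G (t, Inr b))"
      by (simp add: o_def G_def case_prod_unfold)
  qed
  \<comment> \<open>Local compactness and the Hausdorff property of the interval make the product
    with a quotient map a quotient map.\<close>
  have quot: "quotient_map (prod_topology ?I D) (prod_topology ?I X) (\<lambda>(t, d). (t, Q d))"
    by (rule quotient_map_prod_right[OF _ _ quotient_map_glue_proj])
      (simp_all add: Hausdorff_space_subtopology locally_compact_space_closed_subset
        compact_imp_locally_compact_space compact_space_subtopology)
  have fibres: "G p = G p'"
    if p: "p \<in> topspace (prod_topology ?I D)" "p' \<in> topspace (prod_topology ?I D)"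
      and eq: "(case p of (t, d) \<Rightarrow> (t, Q d)) = (case p' of (t, d) \<Rightarrow> (t, Q d))" for p p'
  proof -
    obtain t d d' where p_eqs: "p = (t, d)" "p' = (t, d')" "Q d = Q d'"
      using eq by (cases p; cases p') auto
    \<comment> \<open>Identified points share the time \<open>t\<close>, so compatibility is checked
      within one time slice.\<close>
    have compatible: "glue_compatible Z f (\<lambda>d. G (t, d))"
      unfolding glue_compatible_def
    proof (intro conjI ballI)
      show "G (t, Inr (z, 1)) = G (t, Inr (z', 1))" if "z \<in> topspace Z" "z' \<in> topspace Z" for z z'
        using glue_proj_apex[OF that] by (simp add: G_def ends)
      show "G (t, Inl (f z, 0)) = G (t, Inr (z, 0))" if "z \<in> topspace Z" for z
        using glue_proj_base[of z Z f L] that by (simp add: G_def ends f_in)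
    qed
    show ?thesis
      using glue_proj_eq_imp[OF compatible _ _ p_eqs(3)] p by (simp add: p_eqs)
  qed
  obtain H where H: "continuous_map (prod_topology ?I X) X H"
    and HG: "\<And>p. p \<in> topspace (prod_topology ?I D) \<Longrightarrow> H (case p of (t, d) \<Rightarrow> (t, Q d)) = G p"
  proof (rule quotient_map_lift_exists[OF quot G])
    show "G p = G p'" if "p \<in> topspace (prod_topology ?I D)" "p' \<in> topspace (prod_topology ?I D)"
      "(case p of (t, d) \<Rightarrow> (t, Q d)) = (case p' of (t, d) \<Rightarrow> (t, Q d))" for p p'
      by (rule fibres[OF that])
  qed (rule that)
  show thesis
  proof (rule that[OF H])
    fix t r :: real and x assume "0 \<le> t" "t \<le> 1" "x \<in> topspace L" "0 \<le> r" "r < (1::real)"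
    then show "H (t, Q (Inl (x, r))) = Q (Inl (x, (1 - t) * r))"
      using HG[of "(t, Inl (x, r))"] by (simp add: topspace_disjoint_sum G_def)
  next
    fix t s :: real and z assume "0 \<le> t" "t \<le> 1" "z \<in> topspace Z" "0 \<le> s" "s \<le> (1::real)"
    then show "H (t, Q (Inr (z, s))) = Q (Inr (z, (1 - t) * s + t * \<psi> s))"
      using HG[of "(t, Inr (z, s))"] by (simp add: topspace_disjoint_sum G_def)
  qed
qed

text \<open>Every point slides in height to the base; on the cone, \<open>(z, s)\<close> reaches
  \<open>(z, 0)\<close>, which is attached at \<open>f z\<close>.\<close>

lemma path_connected_glue_cone:
  assumes L: "path_connected_space L"
  shows "path_connected_space X"
proof -
  have base: "path_component_of X (Q (Inl (x, 0))) (Q (Inl (y, 0)))"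
    if xy: "x \<in> topspace L" "y \<in> topspace L" for x y
  proof -
    obtain g where g: "pathin L g" "g 0 = x" "g 1 = y"
      using L xy by (auto simp: path_connected_space_def)
    have "continuous_map (top_of_set {0..1}) (prod_topology L (top_of_set {0..<1})) (\<lambda>t. (g t, 0::real))"
      using g by (intro continuous_map_pairedI) (auto simp: pathin_def)
    from continuous_map_compose[OF this continuous_map_Q_Inl] show ?thesis
      unfolding path_component_of_def using g
      by (intro exI[of _ "\<lambda>t. Q (Inl (g t, 0))"]) (simp add: pathin_def o_def)
  qed
  have to_base: "\<exists>x\<in>topspace L. path_component_of X (Q (Inl (x, 0))) p" if "p \<in> topspace X" for p
    using that
  proof (cases rule: X_cases)
    case (cylinder x r)
    have "continuous_map (top_of_set {0..1}) (prod_topology L (top_of_set {0..<1})) (\<lambda>t. (x, t * r))"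
    proof (intro continuous_map_pairedI continuous_map_into_subtopology)
      show "(\<lambda>t. t * r) \<in> topspace (top_of_set {0..1}) \<rightarrow> {0..<1}"
        using cylinder convex_combination_mem[of "{0..<1}" 0 r] by auto
    qed (use cylinder in \<open>auto intro!: continuous_intros\<close>)
    from continuous_map_compose[OF this continuous_map_Q_Inl] show ?thesis
      using cylinder unfolding path_component_of_def
      by (intro bexI[of _ x] exI[of _ "\<lambda>t. Q (Inl (x, t * r))"]) (simp_all add: pathin_def o_def)
  next
    case (cone z s)
    have "continuous_map (top_of_set {0..1}) (prod_topology Z (top_of_set {0..1})) (\<lambda>t. (z, t * s))"
    proof (intro continuous_map_pairedI continuous_map_into_subtopology)
      show "(\<lambda>t. t * s) \<in> topspace (top_of_set {0..1}) \<rightarrow> {0..1}"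
        using cone convex_combination_mem[of "{0..1}" 0 s] by auto
    qed (use cone in \<open>auto intro!: continuous_intros\<close>)
    from continuous_map_compose[OF this continuous_map_Q_Inr] show ?thesis
      using cone f_in glue_proj_base[of z Z f L] unfolding path_component_of_def
      by (intro bexI[of _ "f z"] exI[of _ "\<lambda>t. Q (Inr (z, t * s))"]) (simp_all add: pathin_def o_def)
  qed
  show ?thesis
    unfolding path_connected_space_iff_path_component
  proof (intro ballI)
    fix p q assume pq: "p \<in> topspace X" "q \<in> topspace X"
    obtain x where x: "x \<in> topspace L" "path_component_of X (Q (Inl (x, 0))) p"
      using to_base[OF pq(1)] by blast
    obtain y where y: "y \<in> topspace L" "path_component_of X (Q (Inl (y, 0))) q"
      using to_base[OF pq(2)] by blast
    have "path_component_of X p (Q (Inl (x, 0)))"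
      using x(2) by (simp add: path_component_of_sym)
    then show "path_component_of X p q"
      by (rule path_component_of_trans[OF _ path_component_of_trans[OF base[OF x(1) y(1)] y(2)]])
  qed
qed

lemma homotopy_cofibre_cover_exists:
  "\<exists>U V i \<rho> \<alpha> \<beta>. homotopy_cofibre_cover X U V L Z i \<rho> \<alpha> \<beta> f"
proof -
  obtain h :: "_ \<Rightarrow> real" where h: "continuous_map X euclideanreal h"
    and h_Inl: "\<And>x r. x \<in> topspace L \<Longrightarrow> 0 \<le> r \<Longrightarrow> r < 1 \<Longrightarrow> h (Q (Inl (x, r))) = - r"
    and h_Inr: "\<And>z s. z \<in> topspace Z \<Longrightarrow> 0 \<le> s \<Longrightarrow> s \<le> 1 \<Longrightarrow> h (Q (Inr (z, s))) = s"
    using height_exists by blast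
  \<comment> \<open>The two ranges of height overlap in the open band between 1/3 and 2/3, so
    \<open>U \<inter> V\<close> consists of cone points away from both base and apex.\<close>
  define U where "U = {p \<in> topspace X. h p \<in> {..<2/3}}"
  define V where "V = {p \<in> topspace X. h p \<in> {1/3<..}}"
  have openU: "openin X U" and openV: "openin X V"
    unfolding U_def V_def by (rule openin_continuous_map_preimage[OF h]; simp)+
  have UI: "Q (Inl (x, r)) \<in> U" if "x \<in> topspace L" "0 \<le> r" "r < 1" for x r
    using that by (simp add: U_def Q_Inl_in h_Inl)
  have VI: "Q (Inl (x, r)) \<notin> V" if "x \<in> topspace L" "0 \<le> r" "r < 1" for x r
    using that by (simp add: V_def h_Inl)
  have UR: "Q (Inr (z, s)) \<in> U \<longleftrightarrow> s < 2/3" if "z \<in> topspace Z" "0 \<le> s" "s \<le> 1" for z s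
    using that by (simp add: U_def Q_Inr_in h_Inr)
  have VR: "Q (Inr (z, s)) \<in> V \<longleftrightarrow> 1/3 < s" if "z \<in> topspace Z" "0 \<le> s" "s \<le> 1" for z s
    using that by (simp add: V_def Q_Inr_in h_Inr)
  have dom_T: "topspace D \<inter> {d. Q d \<in> T} = {d \<in> topspace D. Q d \<in> T}" for T
    by blast

  define i where "i = (\<lambda>x. Q (Inl (x, 0)))"
  have "continuous_map L (prod_topology L (top_of_set {0..<1})) (\<lambda>x. (x, 0::real))"
    by (intro continuous_map_pairedI) auto
  from continuous_map_compose[OF this continuous_map_Q_Inl]
  have i: "continuous_map L (subtopology X U) i"
    by (auto simp: continuous_map_in_subtopology i_def o_def UI)

  \<comment> \<open>The values \<open>undefined\<close> in \<open>?R\<close> and \<open>?B\<close> lie off the open set in question; they make the functions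
    agree at the points identified by the cone relation.\<close>
  let ?R = "case_sum fst (\<lambda>w. if snd w < 1 then f (fst w) else undefined) :: ('a \<times> real) + ('b \<times> real) \<Rightarrow> 'a"
  have R: "glue_compatible Z f ?R"
    by (simp add: glue_compatible_def)
  have "continuous_map (subtopology D {d \<in> topspace D. Q d \<in> U}) L ?R"
    unfolding subtopology_disjoint_sum
  proof (rule continuous_map_disjoint_sum)
    show "continuous_map (subtopology (prod_topology L (top_of_set {0..<1})) (Inl -` {d \<in> topspace D. Q d \<in> U})) L (?R \<circ> Inl)"
      by (auto simp: o_def intro: continuous_map_from_subtopology continuous_map_fst)
    have "continuous_map (subtopology (prod_topology Z (top_of_set {0..1})) (Inr -` {d \<in> topspace D. Q d \<in> U})) L (f \<circ> fst)"
      by (intro continuous_map_from_subtopology continuous_map_compose[OF continuous_map_fst f])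
    then show "continuous_map (subtopology (prod_topology Z (top_of_set {0..1})) (Inr -` {d \<in> topspace D. Q d \<in> U})) L (?R \<circ> Inr)"
      by (rule continuous_map_eq) (auto simp: UR topspace_disjoint_sum)
  qed
  then obtain \<rho> where \<rho>: "continuous_map (subtopology X U) L \<rho>"
    and \<rho>Q: "\<And>d. d \<in> topspace D \<Longrightarrow> Q d \<in> U \<Longrightarrow> \<rho> (Q d) = ?R d"
    using glue_lift_on[OF R openU] by blast
  have \<rho>I: "\<rho> (Q (Inl (x, r))) = x" if "x \<in> topspace L" "0 \<le> r" "r < 1" for x r
    using \<rho>Q[of "Inl (x, r)"] UI[OF that] that by (simp add: topspace_disjoint_sum)
  have \<rho>R: "\<rho> (Q (Inr (z, s))) = f z" if "z \<in> topspace Z" "0 \<le> s" "s < 2/3" for z s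
    using \<rho>Q[of "Inr (z, s)"] UR[of z s] that by (simp add: topspace_disjoint_sum)

  define \<alpha> where "\<alpha> = (\<lambda>z. Q (Inr (z, 1/2)))"
  have "continuous_map Z (prod_topology Z (top_of_set {0..1})) (\<lambda>z. (z, 1/2::real))"
    by (intro continuous_map_pairedI) auto
  from continuous_map_compose[OF this continuous_map_Q_Inr]
  have \<alpha>: "continuous_map Z (subtopology X (U \<inter> V)) \<alpha>"
    by (auto simp: continuous_map_in_subtopology \<alpha>_def o_def UR VR)

  let ?B = "case_sum (\<lambda>_. undefined) (\<lambda>w. if 0 < snd w \<and> snd w < 1 then fst w else undefined) :: ('a \<times> real) + ('b \<times> real) \<Rightarrow> 'b"
  have B: "glue_compatible Z f ?B"
    by (simp add: glue_compatible_def)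
  have "continuous_map (subtopology D {d \<in> topspace D. Q d \<in> U \<inter> V}) Z ?B"
    unfolding subtopology_disjoint_sum
  proof (rule continuous_map_disjoint_sum)
    have "topspace (subtopology (prod_topology L (top_of_set {0..<1})) (Inl -` {d \<in> topspace D. Q d \<in> U \<inter> V})) = {}"
      by (auto simp: VI topspace_disjoint_sum)
    then show "continuous_map (subtopology (prod_topology L (top_of_set {0..<1})) (Inl -` {d \<in> topspace D. Q d \<in> U \<inter> V})) Z (?B \<circ> Inl)"
      by (simp add: continuous_map_def del: topspace_subtopology)
    have "continuous_map (subtopology (prod_topology Z (top_of_set {0..1})) (Inr -` {d \<in> topspace D. Q d \<in> U \<inter> V})) Z fst"
      by (intro continuous_map_from_subtopology continuous_map_fst)
    then show "continuous_map (subtopology (prod_topology Z (top_of_set {0..1})) (Inr -` {d \<in> topspace D. Q d \<in> U \<inter> V})) Z (?B \<circ> Inr)"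
      by (rule continuous_map_eq) (auto simp: UR VR topspace_disjoint_sum)
  qed
  then obtain \<beta> where \<beta>: "continuous_map (subtopology X (U \<inter> V)) Z \<beta>"
    and \<beta>Q: "\<And>d. d \<in> topspace D \<Longrightarrow> Q d \<in> U \<inter> V \<Longrightarrow> \<beta> (Q d) = ?B d"
    using glue_lift_on[OF B openin_Int[OF openU openV]] by blast
  have \<beta>R: "\<beta> (Q (Inr (z, s))) = z" if "z \<in> topspace Z" "1/3 < s" "s < 2/3" for z s
    using \<beta>Q[of "Inr (z, s)"] UR[of z s] VR[of z s] that by (simp add: topspace_disjoint_sum)

  have i_\<rho>: "homotopic_with (\<lambda>_. True) (subtopology X U) (subtopology X U) id (i \<circ> \<rho>)"
  proof -
    \<comment> \<open>This profile vanishes up to height 2/3 and then rises linearly to 1, so at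
      time 1 all of \<open>U\<close> has reached the base.\<close>
    obtain H where H: "continuous_map (prod_topology (top_of_set {0..1::real}) X) X H"
      and HI: "\<And>t x r. 0 \<le> t \<Longrightarrow> t \<le> 1 \<Longrightarrow> x \<in> topspace L \<Longrightarrow> 0 \<le> r \<Longrightarrow> r < 1 \<Longrightarrow>
         H (t, Q (Inl (x, r))) = Q (Inl (x, (1 - t) * r))"
      and HR: "\<And>t z s. 0 \<le> t \<Longrightarrow> t \<le> 1 \<Longrightarrow> z \<in> topspace Z \<Longrightarrow> 0 \<le> s \<Longrightarrow> s \<le> 1 \<Longrightarrow>
         H (t, Q (Inr (z, s))) = Q (Inr (z, (1 - t) * s + t * max 0 (3 * s - 2)))"
      by (rule deformation_exists[of "\<lambda>s. max 0 (3 * s - 2)"]) (auto intro!: continuous_intros)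
    show ?thesis
    proof (rule homotopic_with_subtopology[OF H])
      fix p assume p: "p \<in> topspace X" "p \<in> U"
      show "H (0, p) = p"
        using p(1) by (cases rule: X_cases) (simp_all add: HI HR)
      show "H (1, p) = (i \<circ> \<rho>) p"
        using p(1)
      proof (cases rule: X_cases)
        case (cylinder x r)
        then show ?thesis by (simp add: HI \<rho>I i_def)
      next
        case (cone z s)
        then have "s < 2/3" using p(2) UR by simp
        then show ?thesis
          using cone by (simp add: HR \<rho>R i_def glue_proj_base f_in)
      qed
      fix t :: real assume t: "0 \<le> t" "t \<le> 1"
      show "H (t, p) \<in> U"
        using p(1)
      proof (cases rule: X_cases)
        case (cylinder x r)
        then show ?thesis
          using convex_combination_mem[of "{0..<1}" r 0 t] t by (simp add: HI UI)
      next
        case (cone z s)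
        then have s: "s < 2/3" using p(2) UR by simp
        then have "(1 - t) * s + t * max 0 (3 * s - 2) \<in> {0..<2/3}"
          using t cone by (intro convex_combination_mem) auto
        then show ?thesis
          using cone t by (simp add: HR UR)
      qed
    qed
  qed

  have \<alpha>_\<beta>: "homotopic_with (\<lambda>_. True) (subtopology X (U \<inter> V)) (subtopology X (U \<inter> V)) id (\<alpha> \<circ> \<beta>)"
  proof -
    \<comment> \<open>Piecewise linear through (0, 0), (1/3, 1/2), (2/3, 1/2) and (1, 1): constantly
      1/2 on the band, so that the homotopy ends there in \<open>\<alpha> \<circ> \<beta>\<close>,
      and continued to the required end values.\<close>
    define \<psi> :: "real \<Rightarrow> real" where "\<psi> s = min (3 * s / 2) (max (1/2) ((3 * s - 1) / 2))" for s
    have \<psi>_cont: "continuous_on {0..1} \<psi>"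
      unfolding \<psi>_def[abs_def] by (intro continuous_intros) auto
    have \<psi>_bounds: "0 \<le> \<psi> s \<and> \<psi> s \<le> 1" if "0 \<le> s" "s \<le> 1" for s
      using that by (simp add: \<psi>_def min_le_iff_disj)
    have \<psi>_ends: "\<psi> 0 = 0" "\<psi> 1 = 1"
      by (simp_all add: \<psi>_def)
    obtain H where H: "continuous_map (prod_topology (top_of_set {0..1::real}) X) X H"
      and HR: "\<And>t z s. 0 \<le> t \<Longrightarrow> t \<le> 1 \<Longrightarrow> z \<in> topspace Z \<Longrightarrow> 0 \<le> s \<Longrightarrow> s \<le> 1 \<Longrightarrow>
         H (t, Q (Inr (z, s))) = Q (Inr (z, (1 - t) * s + t * \<psi> s))"
      using deformation_exists[OF \<psi>_cont \<psi>_bounds \<psi>_ends] by metis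
    have \<psi>: "\<psi> s = 1/2" if "1/3 < s" "s < 2/3" for s
      using that by (auto simp: \<psi>_def)
    show ?thesis
    proof (rule homotopic_with_subtopology[OF H])
      fix p assume p: "p \<in> topspace X" "p \<in> U \<inter> V"
      obtain z s where zs: "z \<in> topspace Z" "1/3 < s" "s < 2/3" "p = Q (Inr (z, s))"
        using p(1)
      proof (cases rule: X_cases)
        case (cylinder x r)
        then show thesis using p(2) VI by auto
      next
        case (cone z s)
        then show thesis using that p(2) UR VR by auto
      qed
      show "H (0, p) = p"
        using zs by (simp add: HR)
      show "H (1, p) = (\<alpha> \<circ> \<beta>) p"
        using zs by (simp add: HR \<psi> \<beta>R \<alpha>_def)
      fix t :: real assume t: "0 \<le> t" "t \<le> 1"
      have "(1 - t) * s + t * \<psi> s \<in> {1/3<..<2/3}"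
        using t zs by (intro convex_combination_mem) (auto simp: \<psi>)
      then show "H (t, p) \<in> U \<inter> V"
        using zs t by (simp add: HR UR VR)
    qed
  qed

  have contr: "contractible_space (subtopology X V)"
  proof -
    \<comment> \<open>This profile reaches 1 at height 1/3 and stays there, so all of
      \<open>V\<close> is carried to the apex.\<close>
    obtain H where H: "continuous_map (prod_topology (top_of_set {0..1::real}) X) X H"
      and HR: "\<And>t z s. 0 \<le> t \<Longrightarrow> t \<le> 1 \<Longrightarrow> z \<in> topspace Z \<Longrightarrow> 0 \<le> s \<Longrightarrow> s \<le> 1 \<Longrightarrow>
         H (t, Q (Inr (z, s))) = Q (Inr (z, (1 - t) * s + t * min 1 (3 * s)))"
      by (rule deformation_exists[of "\<lambda>s. min 1 (3 * s)"]) (auto intro!: continuous_intros)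
    \<comment> \<open>The apex is represented by \<open>(z, 1)\<close> for every \<open>z\<close>.
      If \<open>Z\<close> is empty then so is \<open>V\<close>, and any value of \<open>a\<close>
      will do.\<close>
    define a where "a = Q (Inr (SOME z. z \<in> topspace Z, 1))"
    have a: "Q (Inr (z, 1)) = a" if "z \<in> topspace Z" for z
      unfolding a_def by (rule glue_proj_apex[OF that someI[of "\<lambda>z. z \<in> topspace Z", OF that]])
    have "homotopic_with (\<lambda>_. True) (subtopology X V) (subtopology X V) id (\<lambda>_. a)"
    proof (rule homotopic_with_subtopology[OF H])
      fix p assume p: "p \<in> topspace X" "p \<in> V"
      obtain z s where zs: "z \<in> topspace Z" "1/3 < s" "s \<le> 1" "p = Q (Inr (z, s))"
        using p(1)
      proof (cases rule: X_cases)
        case (cylinder x r)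
        then show thesis using p(2) VI by auto
      next
        case (cone z s)
        then show thesis using that p(2) VR by auto
      qed
      show "H (0, p) = p"
        using zs by (simp add: HR)
      show "H (1, p) = a"
        using zs a by (simp add: HR)
      fix t :: real assume t: "0 \<le> t" "t \<le> 1"
      have "(1 - t) * s + t * min 1 (3 * s) \<in> {1/3<..1}"
        using t zs by (intro convex_combination_mem) auto
      then show "H (t, p) \<in> V"
        using zs t by (simp add: HR VR)
    qed
    then show ?thesis
      by (auto simp: contractible_space_def)
  qed

  have "homotopy_cofibre_cover X U V L Z i \<rho> \<alpha> \<beta> f"
  proof
    show "topspace X \<subseteq> U \<union> V"
      by (auto simp: U_def V_def)
    show "\<rho> (i x) = x" if "x \<in> topspace L" for x
      using \<rho>I[OF that] by (simp add: i_def)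
    show "\<rho> (\<alpha> z) = f z" if "z \<in> topspace Z" for z
      using \<rho>R[OF that] by (simp add: \<alpha>_def)
  qed (fact openU openV i \<rho> i_\<rho> \<alpha> \<beta> \<alpha>_\<beta> contr)+
  then show ?thesis by blast
qed

end

section \<open>Reduced homology in the two ranges of degrees\<close>

lemma reduced_real_cycles_Suc: "reduced_real_cycles (Suc m) X = real_cycles (Suc m) X"
  by (simp add: reduced_real_cycles_def)

lemma zero_module_real_homology: "zero_module (real_homology p X) \<longleftrightarrow> real_cycles p X \<subseteq> real_boundaries p X"
  unfolding real_homology_def
  by (rule zero_module_chain_quotient[OF subspace_real_cycles subspace_real_boundaries real_boundaries_subset_cycles])

lemma subspace_reduced_real_cycles: "subspace (reduced_real_cycles p X)"
proof (cases p)
  case 0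
  have "subspace (real_cycles 0 X \<inter> {c. lin_extend (\<lambda>_. 1 :: real) c \<in> {0}})"
    by (intro subspace_inter subspace_real_cycles linear_subspace_linear_preimage[OF linear_lin_extend]) simp
  then show ?thesis
    by (simp add: 0 reduced_real_cycles_def Int_def lin_extend_def)
qed (simp add: reduced_real_cycles_Suc subspace_real_cycles)

theorem theorem5p13:
  fixes L :: "'a topology"
    and \<A> :: "('a set \<times> ('a \<Rightarrow> nat \<Rightarrow> real)) set"
    and l :: nat
    and p :: "nat \<Rightarrow> int"
    and IX :: "(('a \<times> real) + ('b \<times> real) set) set topology"
    and j :: nat
  assumes "smooth_manifold l L \<A>"
    and "simply_connected_space L"
    and "is_intersection_space p l L (open_cone L) IX"
  shows "if 0 < j \<and> int j < int l - p (l + 1)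
         then zero_module (reduced_real_homology j IX)
         else linearly_isomorphic (reduced_real_homology j IX) (reduced_real_homology j L)"
proof -
  define k where "k = int l - p (l + 1)"
  obtain Z :: "'b topology" and f where moore: "moore_approximation k L Z f" and IX: "IX = glue_cone L Z f"
    using assms(3) by (auto simp: is_intersection_space_def k_def)
  interpret cone_gluing L Z f
    using moore by unfold_locales (simp add: moore_approximation_def)
  obtain U V i \<rho> \<alpha> \<beta> where "homotopy_cofibre_cover X U V L Z i \<rho> \<alpha> \<beta> f"
    using homotopy_cofibre_cover_exists by blast
  then interpret homotopy_cofibre_cover X U V L Z i \<rho> \<alpha> \<beta> f .
  have high: "real_cycles m Z \<subseteq> real_boundaries m Z" if "int m \<ge> k" for m
    using moore that by (simp add: moore_approximation_def zero_module_real_homology)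
  have low: "linear_iso (real_homology m Z) (real_homology m L) (real_hom_induced m L f)" if "int m < k" for m
    using moore that by (simp add: moore_approximation_def)
  \<comment> \<open>Below \<open>k\<close> this is part of the isomorphism; from \<open>k\<close> on
    it is trivial, since every cycle of \<open>Z\<close> bounds.\<close>
  have inj: "z \<in> real_boundaries m Z" if "z \<in> real_cycles m Z" "real_chain_map m f z \<in> real_boundaries m L" for m z
  proof (cases "int m < k")
    case True
    then show ?thesis using real_hom_induced_inj[OF low f] that by blast
  next
    case False
    then show ?thesis using high[of m] that by auto
  qed
  show ?thesis
  proof (cases j)
    case 0
    have L: "path_connected_space L"
      using assms(2) by (simp add: simply_connected_space_def)
    \<comment> \<open>Between two zero spaces the zero map is an isomorphism; the displayed map is
      the one induced by \<open>T = 0\<close>.\<close>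
    have "linear_iso (reduced_real_homology 0 X) (reduced_real_homology 0 L)
       (\<lambda>C. {0 + b |c b. c \<in> C \<and> b \<in> real_boundaries 0 L})"
      unfolding reduced_real_homology_def
    proof (rule linear_iso_chain_quotient[OF subspace_reduced_real_cycles subspace_real_boundaries
          subspace_real_boundaries module_hom_zero])
      show "\<exists>z\<in>reduced_real_cycles 0 X. w - 0 \<in> real_boundaries 0 L" if "w \<in> reduced_real_cycles 0 L" for w
        using path_connected_reduced_boundary[OF L that] subspace_0[OF subspace_reduced_real_cycles] by auto
    qed (use path_connected_reduced_boundary[OF path_connected_glue_cone[OF L]]
        subspace_0[OF subspace_reduced_real_cycles] subspace_0[OF subspace_real_boundaries] in auto)
    then show ?thesis
      unfolding linearly_isomorphic_def 0 IX by auto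
  next
    case (Suc m)
    show ?thesis
    proof (cases "int j < k")
      case True
      \<comment> \<open>Injectivity enters in degree \<open>m\<close> and surjectivity in degree
        \<open>Suc m = j\<close>; both degrees are below \<open>k\<close>.\<close>
      then have "real_cycles (Suc m) X \<subseteq> real_boundaries (Suc m) X"
        using cycle_is_boundary[OF _ inj] real_hom_induced_surj[OF low f] Suc by blast
      then have "zero_module (reduced_real_homology j IX)"
        unfolding IX Suc reduced_real_homology_def reduced_real_cycles_Suc
        by (simp add: zero_module_chain_quotient subspace_real_cycles subspace_real_boundaries real_boundaries_subset_cycles)
      then show ?thesis
        using True Suc by (simp add: k_def)
    next
      case False
      have i': "continuous_map L X i"
        using i by (rule continuous_map_into_fulltopology)
      \<comment> \<open>Injective because cycles of \<open>Z\<close> bound in degree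
        \<open>j\<close>; surjective because \<open>f\<close> is injective in degree
        \<open>m\<close>, which still lies below \<open>k\<close> when \<open>j = k\<close>.\<close>
      have "linear_iso (chain_quotient (real_cycles j L) (real_boundaries j L))
          (chain_quotient (real_cycles j X) (real_boundaries j X))
          (\<lambda>C. {real_chain_map j i c + b |c b. c \<in> C \<and> b \<in> real_boundaries j X})"
      proof (rule linear_iso_chain_quotient[OF subspace_real_cycles subspace_real_boundaries
            subspace_real_boundaries linear_real_chain_map])
        show "real_chain_map j i ` real_cycles j L \<subseteq> real_cycles j X"
          using real_chain_map_cycle[OF _ i'] by blast
        show "real_chain_map j i ` real_boundaries j L \<subseteq> real_boundaries j X"
          using real_chain_map_boundary[OF _ i'] by blast
        show "z \<in> real_boundaries j L" if "z \<in> real_cycles j L" "real_chain_map j i z \<in> real_boundaries j X" for z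
          using boundary_in_L[OF that high] False by simp
        show "\<exists>z\<in>real_cycles j L. w - real_chain_map j i z \<in> real_boundaries j X" if "w \<in> real_cycles j X" for w
          using homologous_to_L[OF that[unfolded Suc] inj] unfolding Suc by blast
      qed
      then have "linearly_isomorphic (reduced_real_homology j L) (reduced_real_homology j IX)"
        unfolding IX Suc reduced_real_homology_def reduced_real_cycles_Suc linearly_isomorphic_def by blast
      then have "linearly_isomorphic (reduced_real_homology j IX) (reduced_real_homology j L)"
        unfolding IX Suc reduced_real_homology_def reduced_real_cycles_Suc
        by (rule linearly_isomorphic_chain_quotient_sym[OF _ subspace_real_cycles subspace_real_boundaries])
      then show ?thesis
        using False by (simp add: k_def)
    qed
  qed
qed

end
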